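(* Let $A$ be a complex square matrix with $\sigma(A)\subset\mathbb{D}$ and minimal polynomial $m=\prod_{i=1}^{|m|}(z-\lambda_i)$, and let $B$ be the Blaschke product associated with $m$. The components of the model operator $M_B$ with respect to the Malmquist-Walsh basis are given, for $1\le i,j\le|m|$, by $$(M_B)_{ij}=\begin{cases}0 & \text{if } i<j,\\ \lambda_i & \text{if } i=j,\\ (1-|\lambda_i|^2)^{1/2}(1-|\lambda_j|^2)^{1/2}\displaystyle\prod_{\mu=j+1}^{i-1}\left(-\bar{\lambda}_\mu\right) & \text{if } i>j,\end{cases}$$ where the empty product is $1$.
   Context: $\mathbb{D}$ is the open unit disk and $\sigma(A)$ the spectrum of $A$. The degree of $m$ is denoted $|m|$, and $\lambda_1,\dots,\lambda_{|m|}$ are its zeros listed with multiplicity in $m$, in a fixed order. The Blaschke product associated with $m$ is $B(z)=\prod_{i=1}^{|m|}\frac{z-\lambda_i}{1-\bar\lambda_i z}$. $H_2$ is the Hardy space of analytic functions $f(z)=\sum_{k\ge0}\hat f(k)z^k$ on $\mathbb{D}$ with $\sum_{k\ge0}|\hat f(k)|^2<\infty$, a Hilbert space with inner product $\langle f|g\rangle=\int_{\partial\mathbb{D}}f(z)\overline{g(z)}\frac{|dz|}{2\pi}$ (boundary values). The model space is $K_B=H_2\cap(BH_2)^\perp$, which has dimension $|m|$; the model operator $M_B:K_B\to K_B$ is $M_B(f)=P_B(zf)$, where $P_B$ is the orthogonal projection onto $K_B$. The Malmquist-Walsh basis is the orthonormal basis of $K_B$ given by $e_k(z)=\frac{(1-|\lambda_k|^2)^{1/2}}{1-\bar\lambda_k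 z}\prod_{i=1}^{k-1}\frac{z-\lambda_i}{1-\bar\lambda_i z}$, $k=1,\dots,|m|$ (empty product equal to $1$). Matrix entries of an operator $X$ on $K_B$ are $X_{ij}=\langle Xe_j|e_i\rangle$. *)

theory Defs
  imports
    "HOL-Complex_Analysis.Complex_Analysis"
    "Jordan_Normal_Form.Spectral_Radius"
begin

definition poly_mat :: "complex poly \<Rightarrow> complex mat \<Rightarrow> complex mat" where
  "poly_mat p A = Matrix.mat (dim_row A) (dim_row A)
     (\<lambda>(i, j). \<Sum>k\<le>degree p. coeff p k * (A ^\<^sub>m k) $$ (i, j))"

definition is_minimal_poly :: "complex mat \<Rightarrow> complex poly \<Rightarrow> bool" where
  "is_minimal_poly A m \<longleftrightarrow>
     lead_coeff m = 1 \<and>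
     poly_mat m A = 0\<^sub>m (dim_row A) (dim_row A) \<and>
     (\<forall>q. q \<noteq> 0 \<and> poly_mat q A = 0\<^sub>m (dim_row A) (dim_row A) \<longrightarrow> degree m \<le> degree q)"

text \<open>
  A function on the open unit disk is represented by its extension by zero to the whole plane;
  this makes the representation unique, so that the Hardy space is a genuine space of functions
  and orthogonal projections are uniquely determined.
\<close>

definition hardy_space :: "(complex \<Rightarrow> complex) set" where
  "hardy_space = {f. f holomorphic_on ball 0 1 \<and> (\<forall>z. z \<notin> ball 0 1 \<longrightarrow> f z = 0) \<and>
     summable (\<lambda>k. (cmod (fps_nth (fps_expansion f 0) k))\<^sup>2)}"

text \<open>
  Boundary values are radial limits. By Fatou's theorem they exist at almost every point of the
  circle if the function is in the Hardy space; at other points the value is unspecified.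
\<close>

definition boundary_value :: "(complex \<Rightarrow> complex) \<Rightarrow> real \<Rightarrow> complex" where
  "boundary_value f t = Lim (at_left 1) (\<lambda>r. f (of_real r * cis t))"

definition hardy_inner :: "(complex \<Rightarrow> complex) \<Rightarrow> (complex \<Rightarrow> complex) \<Rightarrow> complex" where
  "hardy_inner f g =
     (LINT t:{0..2 * pi}|lebesgue. boundary_value f t * cnj (boundary_value g t)) / of_real (2 * pi)"

definition hardy_orth :: "(complex \<Rightarrow> complex) set \<Rightarrow> (complex \<Rightarrow> complex) set" where
  "hardy_orth S = {f \<in> hardy_space. \<forall>g\<in>S. hardy_inner f g = 0}"

definition hardy_proj ::
  "(complex \<Rightarrow> complex) set \<Rightarrow> (complex \<Rightarrow> complex) \<Rightarrow> complex \<Rightarrow> complex" where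
  "hardy_proj V f = (THE g. g \<in> V \<and> (\<lambda>z. f z - g z) \<in> hardy_orth V)"

definition blaschke :: "(nat \<Rightarrow> complex) \<Rightarrow> nat \<Rightarrow> complex \<Rightarrow> complex" where
  "blaschke lam n z = (\<Prod>i=1..n. (z - lam i) / (1 - cnj (lam i) * z))"

definition model_space :: "(complex \<Rightarrow> complex) \<Rightarrow> (complex \<Rightarrow> complex) set" where
  "model_space B = hardy_orth ((\<lambda>h z. B z * h z) ` hardy_space)"

definition model_operator ::
  "(complex \<Rightarrow> complex) \<Rightarrow> (complex \<Rightarrow> complex) \<Rightarrow> complex \<Rightarrow> complex" where
  "model_operator B f = hardy_proj (model_space B) (\<lambda>z. z * f z)"

definition malmquist_walsh :: "(nat \<Rightarrow> complex) \<Rightarrow> nat \<Rightarrow> complex \<Rightarrow> complex" where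
  "malmquist_walsh lam k z =
     (if z \<in> ball 0 1
      then of_real (sqrt (1 - (cmod (lam k))\<^sup>2)) / (1 - cnj (lam k) * z)
             * (\<Prod>i\<in>{1..<k}. (z - lam i) / (1 - cnj (lam i) * z))
      else 0)"

text \<open>Matrix entries of an operator with respect to a family of functions numbered from 1.\<close>

definition matrix_entry ::
  "((complex \<Rightarrow> complex) \<Rightarrow> complex \<Rightarrow> complex) \<Rightarrow> (nat \<Rightarrow> complex \<Rightarrow> complex)
    \<Rightarrow> nat \<Rightarrow> nat \<Rightarrow> complex" where
  "matrix_entry X e i j = hardy_inner (X (e j)) (e i)"

end

theory Submission
  imports Defs
begin

text \<open>
  Write \<open>b\<^sub>k\<close> for the Blaschke factor of \<open>\<lambda>\<^sub>k\<close>, \<open>\<beta>\<^sub>j = b\<^sub>1 \<cdots> b\<^sub>j\<close> and \<open>c\<^sub>j = (1 - |\<lambda>\<^sub>j|\<^sup>2)\<^sup>1\<^sup>/\<^sup>2\<close>.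
  Two rational identities contain the matrix. Since \<open>z = (z - \<lambda>\<^sub>j) + \<lambda>\<^sub>j\<close>,
  \<open>z e\<^sub>j = \<lambda>\<^sub>j e\<^sub>j + c\<^sub>j \<beta>\<^sub>j\<close>, and resolving the constant 1 into the kernel at \<open>\<lambda>\<^sub>j\<^sub>+\<^sub>1\<close> and
  \<open>b\<^sub>j\<^sub>+\<^sub>1\<close> gives \<open>\<beta>\<^sub>j = c\<^sub>j\<^sub>+\<^sub>1 e\<^sub>j\<^sub>+\<^sub>1 - cnj \<lambda>\<^sub>j\<^sub>+\<^sub>1 \<beta>\<^sub>j\<^sub>+\<^sub>1\<close>. Iterating the second identity up to
  \<open>\<beta>\<^sub>n = B\<close> expresses \<open>z e\<^sub>j\<close> as the claimed combination of \<open>e\<^sub>j, \<dots>, e\<^sub>n\<close> plus a multiple of \<open>B\<close>.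
  The combination lies in the model space and the multiple of \<open>B\<close> is orthogonal to it, so the
  combination is the projection of \<open>z e\<^sub>j\<close>, and its coefficients are the matrix entries because the
  \<open>e\<^sub>i\<close> are orthonormal (\<open>model_operator_matrix\<close>).

  Both orthogonality statements come from two facts: multiplication by a Blaschke factor is
  isometric, because the factor is unimodular on the circle (\<open>hardy_inner_blaschke_factor\<close>), and the
  Szego kernel reproduces point values (\<open>szego_kernel_reproducing\<close>). Cancelling the common factors
  \<open>b\<^sub>1 \<cdots> b\<^sub>i\<^sub>-\<^sub>1\<close> turns an inner product with \<open>e\<^sub>i\<close> into a point value at \<open>\<lambda>\<^sub>i\<close>, where \<open>b\<^sub>i\<close> vanishes.

  The inner product is an integral of radial limits, so it is of use only once those limits
  are known to exist almost everywhere and to satisfy Parseval's identity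
  (\<open>hardy_inner_disk_series\<close>). Existence is Fatou's theorem (\<open>Fatou_radial_limit\<close>). It is
  deduced from a weak-type inequality for the radial maximal function (\<open>radial_maximal_weak_type\<close>),
  which is proved by the duality argument of Kolmogorov, Seliverstov and Plessner instead of a covering
  lemma: if \<open>E\<close> is the set where \<open>Re f(r(t) e\<^sup>i\<^sup>t)\<close> exceeds a level for a measurable choice of radii \<open>r(t)\<close>,
  the integral of \<open>f(r(t) e\<^sup>i\<^sup>t)\<close> over \<open>E\<close> is the pairing of the coefficients of \<open>f\<close> with the moments of
  \<open>r(t) e\<^sup>i\<^sup>t\<close>, and the square sum of the moments is a double integral of a positive kernel, bounded by
  a multiple of the measure of \<open>E\<close> (\<open>moment_energy\<close>).

  The roots lie in the disk because each root of the minimal polynomial is an eigenvalue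
  (\<open>minimal_poly_root_in_spectrum\<close>).
\<close>

section \<open>The real part of the Szego kernel\<close>

abbreviation arc_measure :: "real set \<Rightarrow> real measure" where
  "arc_measure E \<equiv> restrict_space lborel E"

lemma finite_arc_measure:
  assumes "E \<subseteq> {0..2*pi}" "E \<in> sets borel"
  shows "finite_measure (arc_measure E)"
proof
  have "emeasure lborel E \<le> emeasure lborel {0..2*pi}"
    using assms by (intro emeasure_mono) auto
  then have "emeasure lborel E < \<infinity>"
    by (simp add: order_le_less_trans)
  then show "emeasure (arc_measure E) (space (arc_measure E)) \<noteq> \<infinity>"
    using assms by (simp add: emeasure_restrict_space space_restrict_space)
qed

lemma borel_measurable_cis [measurable]: "cis \<in> borel_measurable borel"
  by (intro borel_measurable_continuous_onI continuous_intros)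

lemma integral_cis:
  fixes k :: int
  shows "(LINT t|arc_measure {0..2*pi}. cis (of_int k * t)) = (if k = 0 then 2 * pi else 0)"
proof (cases "k = 0")
  case True
  then show ?thesis
    by (simp add: measure_restrict_space scaleR_conv_of_real)
next
  case False
  let ?F = "\<lambda>t. cis (of_int k * t) / (\<i> * of_int k)"
  have "(LBINT t. indicator {0..2*pi} t *\<^sub>R cis (of_int k * t)) = ?F (2*pi) - ?F 0"
  proof (rule integral_FTC_Icc)
    show "(?F has_vector_derivative cis (of_int k * x)) (at x within {0..2*pi})" for x
    proof -
      have "((\<lambda>t. cis (of_int k * t)) has_derivative (\<lambda>t. (of_int k * t) *\<^sub>R (\<i> * cis (of_int k * x)))) (at x within {0..2*pi})"
        by (intro has_derivative_cis has_derivative_mult_right has_derivative_ident)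
      then have "((\<lambda>t. cis (of_int k * t) * (1 / (\<i> * of_int k))) has_derivative
          (\<lambda>t. (of_int k * t) *\<^sub>R (\<i> * cis (of_int k * x)) * (1 / (\<i> * of_int k)))) (at x within {0..2*pi})"
        by (rule has_derivative_mult_left)
      moreover have "(of_int k * t) *\<^sub>R (\<i> * cis (of_int k * x)) * (1 / (\<i> * of_int k)) =
          t *\<^sub>R cis (of_int k * x)" for t
        using False by (simp add: scaleR_conv_of_real complex_eq_iff)
      ultimately show ?thesis
        by (simp add: has_vector_derivative_def)
    qed
  qed (auto intro!: continuous_intros)
  also have "\<dots> = 0"
    using cis_multiple_2pi[of "of_int k"] by (simp add: mult_ac)
  finally show ?thesis
    using False by (simp add: integral_restrict_space)
qed

text \<open>
  The real part of the Szego kernel is \<open>(1 + P) / 2\<close>, where \<open>P\<close> is the Poisson kernel. Its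
  positivity is what the estimates below rest on.
\<close>
lemma Re_szego_eq_poisson:
  assumes "z \<noteq> (1::complex)"
  shows "Re (1 / (1 - z)) = (1 + (1 - (cmod z)\<^sup>2) / (cmod (1 - z))\<^sup>2) / 2"
proof -
  have "cmod (1 - z) \<noteq> 0" using assms by simp
  then have "(cmod (1 - z))\<^sup>2 \<noteq> 0" by simp
  moreover have "Re (1 / (1 - z)) = (1 - Re z) / (cmod (1 - z))\<^sup>2"
    by (simp add: Re_divide cmod_power2)
  moreover have "(cmod (1 - z))\<^sup>2 + (1 - (cmod z)\<^sup>2) = 2 * (1 - Re z)"
    unfolding cmod_power2 by (simp add: power2_eq_square algebra_simps)
  ultimately show ?thesis by (simp add: field_simps)
qed

lemma Re_szego_nonneg:
  assumes "cmod z < 1"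
  shows "Re (1 / (1 - z)) \<ge> 0"
proof -
  have "z \<noteq> 1" using assms by auto
  moreover have "(cmod z)\<^sup>2 \<le> 1" using assms by (simp add: power_le_one)
  ultimately show ?thesis by (simp add: Re_szego_eq_poisson)
qed

text \<open>
  For \<open>r\<^sup>2 \<le> \<rho> \<le> r\<close> the distances \<open>1 - \<rho>\<close> and \<open>1 - r\<close> to the circle are comparable, hence so are
  the Poisson kernels of these radii.
\<close>
lemma Re_szego_radius_le:
  fixes r \<rho> :: real and u :: complex
  assumes "cmod u = 1" "0 \<le> r" "r < 1" "r\<^sup>2 \<le> \<rho>" "\<rho> \<le> r"
  shows "Re (1 / (1 - \<rho> * u)) \<le> 8 * Re (1 / (1 - r * u))"
proof -
  have \<rho>: "0 \<le> \<rho>" "\<rho> < 1" using assms by (auto intro: order_trans[OF zero_le_power2])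
  have nr: "cmod (r * u) = r" "cmod (\<rho> * u) = \<rho>" using assms \<rho> by (auto simp: norm_mult)
  have ne: "r * u \<noteq> 1" "\<rho> * u \<noteq> 1" using nr assms \<rho> by (metis norm_one less_irrefl)+
  have pos: "cmod (1 - r * u) > 0" "cmod (1 - \<rho> * u) > 0" using ne by auto
  have "cmod (1 - r * u) \<le> cmod (1 - \<rho> * u) + cmod ((\<rho> - r) * u)"
    using norm_triangle_ineq[of "1 - \<rho> * u" "(\<rho> - r) * u"] by (simp add: algebra_simps)
  also have "cmod ((\<rho> - r) * u) = r - \<rho>" 
    using assms by (simp add: norm_mult flip: of_real_diff)
  also have "r - \<rho> \<le> 1 - \<rho>" using assms by simp
  also have "1 - \<rho> \<le> cmod (1 - \<rho> * u)"
    using norm_triangle_ineq2[of 1 "\<rho> * u"] nr by simp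
  finally have le: "cmod (1 - r * u) \<le> 2 * cmod (1 - \<rho> * u)" by simp
  have "(cmod (1 - r * u))\<^sup>2 \<le> 4 * (cmod (1 - \<rho> * u))\<^sup>2"
    using power_mono[OF le, of 2] by (simp add: power_mult_distrib)
  then have inv: "1 / (cmod (1 - \<rho> * u))\<^sup>2 \<le> 4 / (cmod (1 - r * u))\<^sup>2"
    using pos by (simp add: field_simps)
  have r2: "r\<^sup>2 \<le> 1" using assms by (simp add: power_le_one)
  have "(r\<^sup>2)\<^sup>2 \<le> \<rho>\<^sup>2" using assms by (intro power_mono) auto
  moreover have "1 - (r\<^sup>2)\<^sup>2 = (1 - r\<^sup>2) * (1 + r\<^sup>2)" by (simp add: power2_eq_square algebra_simps)
  moreover have "(1 - r\<^sup>2) * (1 + r\<^sup>2) \<le> (1 - r\<^sup>2) * 2" using r2 by (intro mult_left_mono) auto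
  ultimately have num: "1 - \<rho>\<^sup>2 \<le> 2 * (1 - r\<^sup>2)" by linarith
  define X where "X = (1 - \<rho>\<^sup>2) / (cmod (1 - \<rho> * u))\<^sup>2"
  define Y where "Y = (1 - r\<^sup>2) / (cmod (1 - r * u))\<^sup>2"
  have "(1 - \<rho>\<^sup>2) * (1 / (cmod (1 - \<rho> * u))\<^sup>2) \<le> (2 * (1 - r\<^sup>2)) * (4 / (cmod (1 - r * u))\<^sup>2)"
    using num inv r2 by (intro mult_mono) auto
  then have "X \<le> 8 * Y" by (simp add: X_def Y_def)
  then show ?thesis
    unfolding Re_szego_eq_poisson[OF ne(1)] Re_szego_eq_poisson[OF ne(2)] nr
    by (simp flip: X_def Y_def)
qed

text \<open>
  The product \<open>r s\<close> lies between the square of the smaller radius and the smaller radius. This is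
  what replaces a covering argument: the kernel of a composition of two Poisson means is dominated by
  the kernels of the two factors.
\<close>
lemma Re_szego_mult_radius_le:
  fixes r s :: real and u :: complex
  assumes "0 \<le> r" "r < 1" "0 \<le> s" "s < 1" "cmod u = 1"
  shows "Re (1 / (1 - r * s * u)) \<le> 8 * (Re (1 / (1 - r * u)) + Re (1 / (1 - s * u)))"
proof -
  have pos: "Re (1 / (1 - r * u)) \<ge> 0" "Re (1 / (1 - s * u)) \<ge> 0"
    using assms by (auto intro!: Re_szego_nonneg simp: norm_mult)
  have main: "Re (1 / (1 - of_real (x * y) * u)) \<le> 8 * Re (1 / (1 - x * u))" 
    if "0 \<le> x" "x \<le> y" "y < 1" for x y :: real
    using that assms by (intro Re_szego_radius_le) (auto simp: power2_eq_square intro: mult_left_mono mult_left_le)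
  show ?thesis
  proof (cases "r \<le> s")
    case True
    then show ?thesis using main[of r s] assms pos by simp
  next
    case False
    then show ?thesis using main[of s r] assms pos by (simp add: mult.commute)
  qed
qed

lemma szego_circle_integral:
  assumes "cmod z < 1"
  shows "integrable (arc_measure {0..2*pi}) (\<lambda>s. 1 / (1 - z * cis (-s)))" (is ?A)
    and "(LINT s|arc_measure {0..2*pi}. 1 / (1 - z * cis (-s))) = 2 * pi" (is ?B)
proof -
  interpret finite_measure "arc_measure {0..2*pi}" by (rule finite_arc_measure) auto
  have n: "cmod (z * cis (-s)) < 1" for s using assms by (simp add: norm_mult)
  have lower: "1 - cmod z \<le> cmod (1 - z * cis (-s))" for s
    using norm_triangle_ineq2[of 1 "z * cis (-s)"] by (simp add: norm_mult)
  show ?A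
  proof (rule integrable_const_bound[of _ "1 / (1 - cmod z)"])
    have "norm (1 / (1 - z * cis (-s))) \<le> 1 / (1 - cmod z)" for s
      unfolding norm_divide norm_one using lower[of s] assms by (intro divide_left_mono mult_pos_pos) linarith+
    then show "AE s in arc_measure {0..2*pi}. norm (1 / (1 - z * cis (-s))) \<le> 1 / (1 - cmod z)"
      by simp
    show "(\<lambda>s. 1 / (1 - z * cis (-s))) \<in> borel_measurable (arc_measure {0..2*pi})"
      by (rule measurable_restrict_space1) measurable
  qed
  have sums: "(\<lambda>k. (LINT s|arc_measure {0..2*pi}. (z * cis (-s)) ^ k)) sums
      (LINT s|arc_measure {0..2*pi}. (\<Sum>k. (z * cis (-s)) ^ k))"
  proof (rule sums_integral)
    show "integrable (arc_measure {0..2*pi}) (\<lambda>s. (z * cis (-s)) ^ k)" for k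
    proof (rule integrable_const_bound[of _ 1])
      show "AE s in arc_measure {0..2*pi}. norm ((z * cis (-s)) ^ k) \<le> 1"
        using assms by (simp add: norm_power norm_mult power_le_one)
      show "(\<lambda>s. (z * cis (-s)) ^ k) \<in> borel_measurable (arc_measure {0..2*pi})"
        by (rule measurable_restrict_space1) measurable
    qed
    show "AE s in arc_measure {0..2*pi}. summable (\<lambda>k. norm ((z * cis (-s)) ^ k))"
      using n by (simp add: norm_power summable_geometric)
    show "summable (\<lambda>k. LINT s|arc_measure {0..2*pi}. norm ((z * cis (-s)) ^ k))"
      using assms by (simp add: norm_power norm_mult summable_mult summable_geometric)
  qed
  have c: "(LINT s|arc_measure {0..2*pi}. (z * cis (-s)) ^ k) = (if k = 0 then 2 * pi else 0)" for k
  proof -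
    have "(z * cis (-s)) ^ k = z ^ k * cis (of_int (- int k) * s)" for s
      by (simp add: power_mult_distrib Complex.DeMoivre)
    then show ?thesis using integral_cis[of "- int k"] by auto
  qed
  have "(\<Sum>k. (z * cis (-s)) ^ k) = 1 / (1 - z * cis (-s))" for s
    using n by (rule suminf_geometric)
  then show ?B using sums sums_single[of 0 "\<lambda>_. of_real (2 * pi) :: complex"] unfolding c
    by (simp add: if_distrib sums_unique2 cong: if_cong)
qed

section \<open>A weak-type inequality for the radial maximal function\<close>

lemma borel_measurable_cnj [measurable]: "cnj \<in> borel_measurable borel"
  by (intro borel_measurable_continuous_onI continuous_intros)

definition power_series :: "(nat \<Rightarrow> complex) \<Rightarrow> complex \<Rightarrow> complex" where
  "power_series a z = (\<Sum>k. a k * z ^ k)"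

abbreviation square_summable :: "(nat \<Rightarrow> complex) \<Rightarrow> bool" where
  "square_summable a \<equiv> summable (\<lambda>k. (cmod (a k))\<^sup>2)"

lemma square_summable_imp_abs_summable:
  assumes "square_summable a" "0 \<le> R" "R < 1"
  shows "summable (\<lambda>k. cmod (a k) * R ^ k)"
proof (rule summable_comparison_test')
  have "R\<^sup>2 < 1" using assms by (simp add: power_less_one_iff abs_square_less_1)
  then show "summable (\<lambda>k. ((cmod (a k))\<^sup>2 + (R\<^sup>2) ^ k) / 2)"
    using assms by (intro summable_divide summable_add summable_geometric) auto
  show "norm (cmod (a k) * R ^ k) \<le> ((cmod (a k))\<^sup>2 + (R\<^sup>2) ^ k) / 2" for k
  proof -
    have "0 \<le> (cmod (a k) - R ^ k)\<^sup>2" by simp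
    then have "2 * (cmod (a k) * R ^ k) \<le> (cmod (a k))\<^sup>2 + (R ^ k)\<^sup>2"
      by (simp add: power2_diff)
    moreover have "(R ^ k)\<^sup>2 = (R\<^sup>2) ^ k" by (simp add: power_mult[symmetric] mult.commute)
    ultimately show ?thesis using assms by simp
  qed
qed

lemma arc_integral_le:
  fixes f :: "real \<Rightarrow> real"
  assumes "E \<subseteq> {0..2*pi}" "E \<in> sets borel" "\<And>s. 0 \<le> f s"
    and "integrable (arc_measure {0..2*pi}) f"
  shows "integral\<^sup>L (arc_measure E) f \<le> integral\<^sup>L (arc_measure {0..2*pi}) f"
proof -
  have i: "integrable lborel (\<lambda>s. indicator {0..2*pi} s *\<^sub>R f s)"
    using assms by (simp add: integrable_restrict_space)
  have "integrable lborel (\<lambda>s. indicator E s *\<^sub>R (indicator {0..2*pi} s *\<^sub>R f s))"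
    using assms by (intro integrable_mult_indicator i) auto
  moreover have "(\<lambda>s. indicator E s *\<^sub>R (indicator {0..2*pi} s *\<^sub>R f s)) = (\<lambda>s. indicator E s *\<^sub>R f s)"
    using assms by (auto simp: fun_eq_iff indicator_def)
  ultimately have j: "integrable lborel (\<lambda>s. indicator E s *\<^sub>R f s)" by simp
  have "(LBINT s. indicator E s *\<^sub>R f s) \<le> (LBINT s. indicator {0..2*pi} s *\<^sub>R f s)"
    using assms by (intro integral_mono i j) (auto simp: indicator_def)
  then show ?thesis using assms by (simp add: integral_restrict_space)
qed

text \<open>
  Expanding \<open>|c\<^sub>k|\<^sup>2\<close> as a double integral over \<open>E \<times> E\<close> and summing the geometric series gives the
  integral of \<open>Re (1 / (1 - z(t) cnj z(s)))\<close>. By \<open>Re_szego_mult_radius_le\<close> this is at most 8 times the sum of two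
  kernels, each depending on one radius only; integrated over the full circle in the other variable, each
  is \<open>2 \<pi>\<close>. The bound \<open>R < 1\<close> justifies exchanging sum and integral.
\<close>
lemma moment_energy:
  fixes r :: "real \<Rightarrow> real"
  assumes E: "E \<subseteq> {0..2*pi}" "E \<in> sets borel"
    and r: "r \<in> borel_measurable borel" "\<And>t. 0 \<le> r t" "\<And>t. r t \<le> R" "R < 1"
  defines "c \<equiv> \<lambda>k. LINT t|arc_measure E. (r t * cis t) ^ k"
  shows "square_summable c" "(\<Sum>k. (cmod (c k))\<^sup>2) \<le> 32 * pi * measure lborel E"
proof -
  define M where "M = arc_measure E"
  define z where "z = (\<lambda>t. r t * cis t)"
  have R: "0 \<le> R" using r(2)[of 0] r(3)[of 0] by linarith
  interpret M: finite_measure M unfolding M_def by (rule finite_arc_measure[OF E])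
  interpret MM: pair_sigma_finite M M ..
  interpret MM: finite_measure "M \<Otimes>\<^sub>M M"
    by (rule finite_measure_pair_measure) unfold_locales
  have spM: "space M = E" using E by (simp add: M_def space_restrict_space)
  have [measurable]: "z \<in> borel_measurable M" "cis \<in> borel_measurable M" "(\<lambda>t. t) \<in> borel_measurable M"
    unfolding M_def z_def using r(1) by (auto intro!: measurable_restrict_space1)
  have nz: "cmod (z t) = r t" for t using r by (simp add: z_def norm_mult)
  have nzR: "cmod (z t) \<le> R" for t using nz r by simp
  have nzz: "cmod (z t * cnj (z s)) \<le> R" for t s
    using mult_mono[OF nzR[of t] nzR[of s]] R r(4) mult_left_le[of R R]
    by (simp add: norm_mult)
  have nzz1: "cmod (z t * cnj (z s)) < 1" for t s using nzz[of t s] r(4) by simp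
  define K where "K = (\<lambda>(t, s). Re (1 / (1 - z t * cis (- s))))"
  have K: "0 \<le> K p" "\<bar>K p\<bar> \<le> 1 / (1 - R)" for p
  proof -
    obtain t s where p: "p = (t, s)" by (cases p)
    let ?w = "z t * cis (- s)"
    have w: "cmod ?w \<le> R" using nzR by (simp add: norm_mult)
    then have "cmod ?w < 1" using r by simp
    then show "0 \<le> K p" unfolding K_def p by (simp add: Re_szego_nonneg del: Re_divide_numeral)
    have l: "1 - R \<le> cmod (1 - ?w)"
      using norm_triangle_ineq2[of 1 ?w] w by simp
    have "\<bar>K p\<bar> \<le> cmod (1 / (1 - ?w))" unfolding K_def p prod.case by (rule abs_Re_le_cmod)
    also have "\<dots> \<le> 1 / (1 - R)"
      unfolding norm_divide norm_one using l r by (intro divide_left_mono mult_pos_pos) linarith+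
    finally show "\<bar>K p\<bar> \<le> 1 / (1 - R)" .
  qed
  have Km[measurable]: "K \<in> borel_measurable (M \<Otimes>\<^sub>M M)"
    unfolding K_def by measurable
  have Ki: "integrable (M \<Otimes>\<^sub>M M) K"
    using K by (intro MM.integrable_const_bound[of _ "1 / (1 - R)"]) auto
  have Ki': "integrable (M \<Otimes>\<^sub>M M) (\<lambda>(t, s). K (s, t))"
    using Ki by (simp add: MM.integrable_product_swap_iff)
  have Kint: "integral\<^sup>L (M \<Otimes>\<^sub>M M) K \<le> 2 * pi * measure lborel E"
  proof -
    have inner: "(LINT s|M. K (t, s)) \<le> 2 * pi" for t
    proof -
      have z1: "cmod (z t) < 1" using nzR[of t] r(4) by simp
      have "(LINT s|M. K (t, s)) \<le> (LINT s|arc_measure {0..2*pi}. K (t, s))"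
        unfolding M_def using E K szego_circle_integral(1)[OF z1]
        by (intro arc_integral_le) (auto simp: K_def intro!: integrable_Re)
      also have "\<dots> = Re (2 * pi)"
        unfolding K_def using szego_circle_integral[OF z1] by (simp del: Re_divide_numeral)
      finally show ?thesis by simp
    qed
    have "integral\<^sup>L (M \<Otimes>\<^sub>M M) K = (LINT t|M. LINT s|M. K (t, s))"
      by (rule MM.integral_fst'[OF Ki, symmetric])
    also have "\<dots> \<le> (LINT t|M. 2 * pi)"
      using Ki inner by (intro integral_mono MM.integrable_fst') auto
    also have "\<dots> = 2 * pi * measure lborel E"
      using E by (simp add: M_def measure_restrict_space space_restrict_space)
    finally show ?thesis .
  qed
  define h where "h = (\<lambda>k (t, s). (z t * cnj (z s)) ^ k)"
  have [measurable]: "h k \<in> borel_measurable (M \<Otimes>\<^sub>M M)" for k unfolding h_def by measurable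
  have hb: "cmod (h k p) \<le> R ^ k" for k p
    using nzz by (cases p) (simp add: h_def norm_power power_mono del: complex_mod_mult_cnj)
  have hi: "integrable (M \<Otimes>\<^sub>M M) (h k)" for k
    using hb by (intro MM.integrable_const_bound[of _ "R ^ k"]) auto
  have hc: "integral\<^sup>L (M \<Otimes>\<^sub>M M) (h k) = (cmod (c k))\<^sup>2" for k
  proof -
    have "integral\<^sup>L (M \<Otimes>\<^sub>M M) (h k) = (LINT t|M. LINT s|M. z t ^ k * cnj (z s ^ k))"
      by (subst MM.integral_fst'[OF hi, symmetric]) (simp add: h_def power_mult_distrib)
    also have "\<dots> = (LINT t|M. z t ^ k * cnj (c k))"
    proof -
      have "(LINT s|M. cnj (z s ^ k)) = cnj (LINT s|M. z s ^ k)" by (rule Bochner_Integration.integral_cnj)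
      also have "(LINT s|M. z s ^ k) = c k" by (simp only: c_def z_def M_def)
      finally have "(LINT s|M. cnj (z s ^ k)) = cnj (c k)" .
      then show ?thesis by (simp only: integral_mult_right_zero)
    qed
    also have "\<dots> = (LINT t|M. z t ^ k) * cnj (c k)"
      by (rule integral_mult_left_zero)
    also have "(LINT t|M. z t ^ k) = c k" by (simp only: c_def z_def M_def)
    finally show ?thesis by (simp only: complex_norm_square)
  qed
  have sums: "(\<lambda>k. integral\<^sup>L (M \<Otimes>\<^sub>M M) (h k)) sums (LINT p|(M \<Otimes>\<^sub>M M). (\<Sum>k. h k p))"
  proof (rule sums_integral[OF hi])
    have sR: "summable (\<lambda>k. R ^ k)" using R r by (intro summable_geometric) auto
    show "AE p in (M \<Otimes>\<^sub>M M). summable (\<lambda>k. norm (h k p))"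
      using hb by (intro AE_I2 summable_comparison_test'[OF sR]) auto
    show "summable (\<lambda>k. LINT p|(M \<Otimes>\<^sub>M M). norm (h k p))"
    proof (rule summable_comparison_test')
      show "summable (\<lambda>k. measure (M \<Otimes>\<^sub>M M) (space (M \<Otimes>\<^sub>M M)) * R ^ k)"
        by (rule summable_mult[OF sR])
      show "norm (LINT p|(M \<Otimes>\<^sub>M M). norm (h k p)) \<le> measure (M \<Otimes>\<^sub>M M) (space (M \<Otimes>\<^sub>M M)) * R ^ k" for k
      proof -
        have "(LINT p|(M \<Otimes>\<^sub>M M). norm (h k p)) \<le> (LINT p|(M \<Otimes>\<^sub>M M). R ^ k)"
          using hi hb by (intro integral_mono integrable_norm) auto
        then show ?thesis by (simp add: integral_nonneg_AE)
      qed
    qed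
  qed
  define G where "G = (\<lambda>(t, s). 1 / (1 - z t * cnj (z s)))"
  have G: "(\<Sum>k. h k p) = G p" for p
    using nzz1 by (cases p) (simp add: h_def G_def suminf_geometric del: complex_mod_mult_cnj)
  have [measurable]: "G \<in> borel_measurable (M \<Otimes>\<^sub>M M)" unfolding G_def by measurable
  have Gb: "cmod (G p) \<le> 1 / (1 - R)" for p
  proof -
    obtain t s where p: "p = (t, s)" by (cases p)
    have "1 - R \<le> cmod (1 - z t * cnj (z s))"
      using norm_triangle_ineq2[of 1 "z t * cnj (z s)"] nzz[of t s] by simp
    then show ?thesis
      unfolding G_def p prod.case norm_divide norm_one using r 
      by (intro divide_left_mono mult_pos_pos) linarith+
  qed
  have Gi: "integrable (M \<Otimes>\<^sub>M M) G"
    using Gb by (intro MM.integrable_const_bound[of _ "1 / (1 - R)"]) auto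
  have sums': "(\<lambda>k. (cmod (c k))\<^sup>2) sums (LINT p|(M \<Otimes>\<^sub>M M). Re (G p))"
    using sums_Re[OF sums] Gi by (simp add: G hc)
  show "square_summable c" using sums' by (rule sums_summable)
  have le: "Re (G p) \<le> 8 * (K p + (case p of (t, s) \<Rightarrow> K (s, t)))" for p
  proof -
    obtain t s where p: "p = (t, s)" by (cases p)
    have u: "z t * cnj (z s) = r t * r s * cis (t - s)"
      by (simp add: z_def cis_cnj divide_inverse mult_ac flip: cis_divide)
    have c: "Re (1 / (1 - r s * cis (t - s))) = K (s, t)"
    proof -
      have "cnj (1 / (1 - r s * cis (t - s))) = 1 / (1 - z s * cis (- t))"
        by (simp add: z_def cis_cnj cis_mult)
      then show ?thesis unfolding K_def by (metis complex_cnj(1) prod.case cnj.sel(1))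
    qed
    have "Re (1 / (1 - r t * r s * cis (t - s))) \<le>
        8 * (Re (1 / (1 - r t * cis (t - s))) + Re (1 / (1 - r s * cis (t - s))))"
      using r order_le_less_trans[OF r(3,4)] by (intro Re_szego_mult_radius_le) auto
    moreover have "r t * cis (t - s) = z t * cis (- s)"
      by (simp add: z_def cis_mult)
    ultimately show ?thesis unfolding p G_def prod.case u c by (simp add: K_def)
  qed
  have "(\<Sum>k. (cmod (c k))\<^sup>2) = (LINT p|(M \<Otimes>\<^sub>M M). Re (G p))"
    using sums' by (simp add: sums_iff)
  also have "\<dots> \<le> (LINT p|(M \<Otimes>\<^sub>M M). 8 * (K p + (case p of (t, s) \<Rightarrow> K (s, t))))"
    using Gi Ki Ki' le by (intro integral_mono integrable_Re integrable_mult_right Bochner_Integration.integrable_add) auto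
  also have "\<dots> = 8 * (integral\<^sup>L (M \<Otimes>\<^sub>M M) K + integral\<^sup>L (M \<Otimes>\<^sub>M M) K)"
    using Ki Ki' MM.integral_product_swap[OF Km] by simp
  also have "\<dots> \<le> 32 * pi * measure lborel E" using Kint by simp
  finally show "(\<Sum>k. (cmod (c k))\<^sup>2) \<le> 32 * pi * measure lborel E" .
qed

lemma power_series_measurable [measurable]:
  "power_series a \<in> borel_measurable borel"
  unfolding power_series_def by measurable

lemma norm_power_series_le:
  assumes "square_summable a" "cmod z \<le> R" "R < 1"
  shows "cmod (power_series a z) \<le> (\<Sum>k. cmod (a k) * R ^ k)"
proof -
  have R: "0 \<le> R" using assms(2) norm_ge_zero order_trans by blast
  note s = square_summable_imp_abs_summable[OF assms(1) R assms(3)]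
  have le: "norm (a k * z ^ k) \<le> cmod (a k) * R ^ k" for k
    using assms by (auto simp: norm_mult norm_power intro!: mult_left_mono power_mono)
  show ?thesis unfolding power_series_def
    by (rule norm_suminf_le[OF le s])
qed

text \<open>
  With \<open>r(t)\<close> the first radius that exceeds the level, the integral of \<open>Re f(r(t) e\<^sup>i\<^sup>t)\<close> over \<open>E\<close> is at
  least \<open>\<tau> |E|\<close>. It also equals the real part of \<open>\<Sum> a\<^sub>k c\<^sub>k\<close>, and the arithmetic-geometric mean inequality with
  \<open>moment_energy\<close> bounds this by a multiple of the energy of \<open>a\<close> plus \<open>\<tau> |E| / 2\<close>, which is absorbed.
  Finitely many radii stay away from 1, as \<open>moment_energy\<close> requires.
\<close>
lemma weak_type_finite:
  fixes rs :: "nat \<Rightarrow> real" and m :: nat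
  assumes a: "square_summable a" and rs: "\<And>i. 0 \<le> rs i" "\<And>i. rs i < 1" and l: "0 < \<tau>"
  defines "E \<equiv> {t \<in> {0..2*pi}. \<exists>i<m. \<tau> < Re (power_series a (rs i * cis t))}"
  shows "E \<in> sets borel" "measure lborel E \<le> 32 * pi * (\<Sum>k. (cmod (a k))\<^sup>2) / \<tau>\<^sup>2"
proof -
  define P where "P = (\<lambda>i t. i < m \<and> \<tau> < Re (power_series a (rs i * cis t)))"
  have [measurable]: "Measurable.pred borel (P i)" for i unfolding P_def by measurable
  have Eeq: "E = {0..2*pi} \<inter> {t. \<exists>i. P i t}" by (auto simp: E_def P_def)
  show E: "E \<in> sets borel" unfolding Eeq by measurable
  have EI: "E \<subseteq> {0..2*pi}" by (auto simp: E_def)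
  define R where "R = Max (insert 0 (rs ` {..<m}))"
  have R: "0 \<le> R" "R < 1" "\<And>i. i < m \<Longrightarrow> rs i \<le> R"
    using rs by (auto simp: R_def)
  define r where "r = (\<lambda>t. if \<exists>i. P i t then rs (LEAST i. P i t) else 0)"
  have rm [measurable]: "r \<in> borel_measurable borel"
    unfolding r_def by measurable
  have r: "0 \<le> r t" "r t \<le> R" for t
    using rs R LeastI_ex[of "\<lambda>i. P i t"] by (auto simp: r_def P_def)
  have rE: "\<tau> \<le> Re (power_series a (r t * cis t))" if "t \<in> E" for t
    using that LeastI_ex[of "\<lambda>i. P i t"] by (auto simp: r_def P_def Eeq)
  define c where "c = (\<lambda>k. LINT t|arc_measure E. (r t * cis t) ^ k)"
  have c: "square_summable c" "(\<Sum>k. (cmod (c k))\<^sup>2) \<le> 32 * pi * measure lborel E"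
    unfolding c_def by (rule moment_energy[OF EI E rm r R(2)])+
  interpret finite_measure "arc_measure E" by (rule finite_arc_measure[OF EI E])
  have zm: "(\<lambda>t. r t * cis t) \<in> borel_measurable (arc_measure E)"
    by (rule measurable_restrict_space1) measurable
  note [measurable] = zm
  have nz: "cmod (r t * cis t) \<le> R" for t using r by (simp add: norm_mult)
  note sR = square_summable_imp_abs_summable[OF a R(1,2)]
  have nk: "cmod (a k * (r t * cis t) ^ k) \<le> cmod (a k) * R ^ k" for k t
    using r by (auto simp: norm_mult norm_power intro!: mult_left_mono power_mono)
  have ik: "integrable (arc_measure E) (\<lambda>t. a k * (r t * cis t) ^ k)" for k
    using nk by (intro integrable_const_bound[of _ "cmod (a k) * R ^ k"]) auto
  have "(\<lambda>k. LINT t|arc_measure E. a k * (r t * cis t) ^ k) sums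
      (LINT t|arc_measure E. (\<Sum>k. a k * (r t * cis t) ^ k))"
  proof (rule sums_integral[OF ik])
    show "AE t in arc_measure E. summable (\<lambda>k. norm (a k * (r t * cis t) ^ k))"
      using nk by (intro AE_I2 summable_comparison_test'[OF sR]) auto
    show "summable (\<lambda>k. LINT t|arc_measure E. norm (a k * (r t * cis t) ^ k))"
    proof (rule summable_comparison_test'[OF summable_mult[OF sR]])
      show "norm (LINT t|arc_measure E. norm (a k * (r t * cis t) ^ k))
          \<le> measure (arc_measure E) (space (arc_measure E)) * (cmod (a k) * R ^ k)" for k
      proof -
        have "(LINT t|arc_measure E. norm (a k * (r t * cis t) ^ k)) \<le> (LINT t|arc_measure E. cmod (a k) * R ^ k)"
          using ik nk by (intro integral_mono integrable_norm) auto
        then show ?thesis by (simp add: integral_nonneg_AE)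
      qed
    qed
  qed
  then have "(\<lambda>k. a k * c k) sums (LINT t|arc_measure E. power_series a (r t * cis t))"
    by (simp add: c_def power_series_def)
  then have sums: "(\<lambda>k. Re (a k * c k)) sums Re (LINT t|arc_measure E. power_series a (r t * cis t))"
    by (rule sums_Re)
  have pi: "integrable (arc_measure E) (\<lambda>t. power_series a (r t * cis t))"
  proof (rule integrable_const_bound)
    show "AE t in arc_measure E. norm (power_series a (r t * cis t)) \<le> (\<Sum>k. cmod (a k) * R ^ k)"
      using norm_power_series_le[OF a nz R(2)] by simp
    show "(\<lambda>t. power_series a (r t * cis t)) \<in> borel_measurable (arc_measure E)"
      by (rule measurable_compose[OF zm power_series_measurable])
  qed
  have spE: "space (arc_measure E) = E" "measure (arc_measure E) E = measure lborel E"
    using E by (simp_all add: space_restrict_space measure_restrict_space)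
  have "\<tau> * measure lborel E = (LINT t|arc_measure E. \<tau>)"
    using spE by simp
  also have "\<dots> \<le> (LINT t|arc_measure E. Re (power_series a (r t * cis t)))"
    using pi rE spE by (intro integral_mono integrable_Re) auto
  also have "\<dots> = (\<Sum>k. Re (a k * c k))"
    using pi sums by (simp add: sums_iff)
  \<comment> \<open>The weights are balanced so that the moment term is at most half of the left-hand side.\<close>
  also have "\<dots> \<le> (\<Sum>k. (16 * pi / \<tau>) * (cmod (a k))\<^sup>2 + (\<tau> / (64 * pi)) * (cmod (c k))\<^sup>2)"
  proof (rule suminf_le)
    show "Re (a k * c k) \<le> (16 * pi / \<tau>) * (cmod (a k))\<^sup>2 + (\<tau> / (64 * pi)) * (cmod (c k))\<^sup>2" for k
    proof -
      define x where "x = sqrt (16 * pi / \<tau>) * cmod (a k)"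
      define y where "y = sqrt (\<tau> / (64 * pi)) * cmod (c k)"
      have "sqrt (16 * pi / \<tau>) * sqrt (\<tau> / (64 * pi)) = sqrt ((1 / 2)\<^sup>2)"
        using l by (simp add: power2_eq_square flip: real_sqrt_mult)
      then have half: "sqrt (16 * pi / \<tau>) * sqrt (\<tau> / (64 * pi)) = 1 / 2"
        by simp
      have "2 * (x * y) = 2 * (sqrt (16 * pi / \<tau>) * sqrt (\<tau> / (64 * pi))) * (cmod (a k) * cmod (c k))"
        by (simp only: x_def y_def mult_ac)
      then have "2 * (x * y) = cmod (a k * c k)"
        unfolding half norm_mult by simp
      moreover have "2 * (x * y) \<le> x\<^sup>2 + y\<^sup>2"
        using sum_squares_bound[of x y] by simp
      moreover have "x\<^sup>2 = 16 * pi / \<tau> * (cmod (a k))\<^sup>2" "y\<^sup>2 = \<tau> / (64 * pi) * (cmod (c k))\<^sup>2"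
        using l by (simp_all add: x_def y_def power_mult_distrib)
      ultimately show ?thesis using complex_Re_le_cmod[of "a k * c k"] by linarith
    qed
    show "summable (\<lambda>k. Re (a k * c k))" using sums by (rule sums_summable)
    show "summable (\<lambda>k. (16 * pi / \<tau>) * (cmod (a k))\<^sup>2 + (\<tau> / (64 * pi)) * (cmod (c k))\<^sup>2)"
      using a c(1) by (intro summable_add summable_mult)
  qed
  also have "\<dots> = (16 * pi / \<tau>) * (\<Sum>k. (cmod (a k))\<^sup>2) + (\<tau> / (64 * pi)) * (\<Sum>k. (cmod (c k))\<^sup>2)"
    unfolding suminf_mult[OF a, symmetric] suminf_mult[OF c(1), symmetric]
    by (rule suminf_add[symmetric]) (intro summable_mult a c(1))+
  also have "\<dots> \<le> (16 * pi / \<tau>) * (\<Sum>k. (cmod (a k))\<^sup>2) + (\<tau> / (64 * pi)) * (32 * pi * measure lborel E)"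
    using l c(2) by (intro add_left_mono mult_left_mono) auto
  finally have "\<tau> * measure lborel E / 2 \<le> (16 * pi / \<tau>) * (\<Sum>k. (cmod (a k))\<^sup>2)"
    by (simp add: field_simps)
  then have "(2 / \<tau>) * (\<tau> * measure lborel E / 2) \<le> (2 / \<tau>) * ((16 * pi / \<tau>) * (\<Sum>k. (cmod (a k))\<^sup>2))"
    using l by (intro mult_left_mono) auto
  then show "measure lborel E \<le> 32 * pi * (\<Sum>k. (cmod (a k))\<^sup>2) / \<tau>\<^sup>2"
    using l by (simp add: power2_eq_square mult_ac)
qed

lemma isCont_power_series:
  assumes "square_summable a" "cmod z < 1"
  shows "isCont (power_series a) z"
proof -
  obtain K where K: "cmod z < K" "K < 1" using assms(2) dense by blast
  then have "0 \<le> K" using norm_ge_zero[of z] by linarith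
  then have "summable (\<lambda>k. norm (a k * of_real K ^ k))"
    using square_summable_imp_abs_summable[OF assms(1) _ K(2)] by (simp add: norm_mult norm_power)
  then have "summable (\<lambda>k. a k * of_real K ^ k)" by (rule summable_norm_cancel)
  then show ?thesis unfolding power_series_def[abs_def]
    by (rule isCont_powser) (use K \<open>0 \<le> K\<close> in simp)
qed

lemma power_series_sums:
  assumes "square_summable a" "cmod z < 1"
  shows "(\<lambda>k. a k * z ^ k) sums power_series a z"
proof -
  have "summable (\<lambda>k. norm (a k * z ^ k))"
    using square_summable_imp_abs_summable[OF assms(1) norm_ge_zero assms(2)]
    by (simp add: norm_mult norm_power)
  then show ?thesis
    unfolding power_series_def by (rule summable_sums[OF summable_norm_cancel])
qed

lemma power_series_scale:
  assumes "square_summable a" "cmod z < 1"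
  shows "power_series (\<lambda>k. w * a k) z = w * power_series a z"
  using sums_mult[OF power_series_sums[OF assms], of w]
  by (simp add: power_series_def sums_iff mult.assoc)

lemma weak_type_countable:
  fixes rs :: "nat \<Rightarrow> real"
  assumes a: "square_summable a" and rs: "\<And>i. 0 \<le> rs i" "\<And>i. rs i < 1" and \<tau>: "0 < \<tau>"
  defines "E \<equiv> {t \<in> {0..2*pi}. \<exists>i. \<tau> < Re (power_series a (rs i * cis t))}"
  shows "E \<in> sets borel" "emeasure lborel E \<le> ennreal (32 * pi * (\<Sum>k. (cmod (a k))\<^sup>2) / \<tau>\<^sup>2)"
proof -
  define F where "F = (\<lambda>m::nat. {t \<in> {0..2*pi}. \<exists>i<m. \<tau> < Re (power_series a (rs i * cis t))})"
  have F: "F m \<in> sets borel" "measure lborel (F m) \<le> 32 * pi * (\<Sum>k. (cmod (a k))\<^sup>2) / \<tau>\<^sup>2" for m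
    unfolding F_def by (rule weak_type_finite[OF a rs \<tau>])+
  have eq: "E = (\<Union>m. F m)" by (auto simp: E_def F_def)
  show "E \<in> sets borel" unfolding eq using F by auto
  have "incseq F" by (auto simp: incseq_def F_def intro: less_le_trans)
  then have "emeasure lborel E = (SUP m. emeasure lborel (F m))"
    unfolding eq using F by (intro SUP_emeasure_incseq[symmetric]) auto
  also have "\<dots> \<le> ennreal (32 * pi * (\<Sum>k. (cmod (a k))\<^sup>2) / \<tau>\<^sup>2)"
  proof (rule SUP_least)
    fix m
    have "emeasure lborel (F m) \<le> emeasure lborel {0..2*pi}"
      by (intro emeasure_mono) (auto simp: F_def)
    then have "emeasure lborel (F m) \<noteq> \<infinity>" by (auto simp: top_unique)
    then show "emeasure lborel (F m) \<le> ennreal (32 * pi * (\<Sum>k. (cmod (a k))\<^sup>2) / \<tau>\<^sup>2)"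
      using F(2)[of m] by (simp add: emeasure_eq_ennreal_measure ennreal_leI)
  qed
  finally show "emeasure lborel E \<le> ennreal (32 * pi * (\<Sum>k. (cmod (a k))\<^sup>2) / \<tau>\<^sup>2)" .
qed

text \<open>
  The modulus is controlled by the real parts of \<open>w f\<close> for the four fourth roots of unity \<open>w\<close>, and by
  continuity the rational radii suffice.
\<close>
lemma radial_maximal_weak_type:
  assumes a: "square_summable a" and \<tau>: "0 < \<tau>"
  obtains S where "S \<in> sets borel" 
    "emeasure lborel S \<le> ennreal (128 * pi * (\<Sum>k. (cmod (a k))\<^sup>2) / \<tau>\<^sup>2)"
    "\<And>t r. \<lbrakk>t \<in> {0..2*pi}; t \<notin> S; 0 \<le> r; r < 1\<rbrakk> \<Longrightarrow> cmod (power_series a (of_real r * cis t)) \<le> 2 * \<tau>"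
proof -
  define D where "D = \<rat> \<inter> {0..<1::real}"
  have "countable D" unfolding D_def using countable_rat by auto
  moreover have "0 \<in> D" by (simp add: D_def)
  ultimately have rsD: "range (from_nat_into D) = D" by (intro range_from_nat_into) auto
  define rs where "rs = from_nat_into D"
  have rs: "0 \<le> rs i" "rs i < 1" for i using rsD unfolding rs_def D_def by (metis IntD2 atLeastLessThan_iff rangeI)+
  define W where "W = {1, -1, \<i>, -\<i>}"
  define T where "T = (\<lambda>w. {t \<in> {0..2*pi}. \<exists>i. \<tau> < Re (power_series (\<lambda>k. w * a k) (rs i * cis t))})"
  have W: "cmod w = 1" if "w \<in> W" for w using that by (auto simp: W_def)
  have T: "T w \<in> sets borel" 
    "emeasure lborel (T w) \<le> ennreal (32 * pi * (\<Sum>k. (cmod (a k))\<^sup>2) / \<tau>\<^sup>2)" if "w \<in> W" for w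
    using weak_type_countable[of "\<lambda>k. w * a k" rs \<tau>] a rs \<tau> W[OF that] 
    by (simp_all add: T_def norm_mult)
  show ?thesis
  proof (rule that[of "\<Union>w\<in>W. T w"])
    show "(\<Union>w\<in>W. T w) \<in> sets borel" using T by (intro sets.finite_UN) (auto simp: W_def)
    have nn: "0 \<le> 32 * pi * (\<Sum>k. (cmod (a k))\<^sup>2) / \<tau>\<^sup>2"
      using a by (intro divide_nonneg_nonneg mult_nonneg_nonneg suminf_nonneg) auto
    have "emeasure lborel (\<Union>w\<in>W. T w) \<le> (\<Sum>w\<in>W. emeasure lborel (T w))"
      using T by (intro emeasure_subadditive_finite) (auto simp: W_def)
    also have "\<dots> \<le> (\<Sum>w\<in>W. ennreal (32 * pi * (\<Sum>k. (cmod (a k))\<^sup>2) / \<tau>\<^sup>2))"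
      using T by (intro sum_mono)
    also have "\<dots> = ennreal (real (card W) * (32 * pi * (\<Sum>k. (cmod (a k))\<^sup>2) / \<tau>\<^sup>2))"
      by (subst sum_ennreal) (use nn in simp_all)
    also have "card W = 4"
      by (simp add: W_def complex_eq_iff)
    finally show "emeasure lborel (\<Union>w\<in>W. T w) \<le> ennreal (128 * pi * (\<Sum>k. (cmod (a k))\<^sup>2) / \<tau>\<^sup>2)"
      by (simp add: mult.assoc)
  next
    fix t r :: real assume t: "t \<in> {0..2*pi}" "t \<notin> (\<Union>w\<in>W. T w)" and r: "0 \<le> r" "r < 1"
    have Re_le: "Re (w * power_series a (r * cis t)) \<le> \<tau>" if w: "w \<in> W" for w
    proof (rule ccontr)
      assume "\<not> ?thesis"
      then have gt: "\<tau> < Re (w * power_series a (r * cis t))" by simp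
      have "isCont (\<lambda>x::real. power_series a (x * cis t)) r"
      proof (rule isCont_o2[where g = "power_series a"])
        show "isCont (\<lambda>x::real. x * cis t) r" by (intro continuous_intros)
        show "isCont (power_series a) (r * cis t)"
          using r by (intro isCont_power_series[OF a]) (simp add: norm_mult)
      qed
      then have "isCont (\<lambda>x::real. Re (w * power_series a (x * cis t))) r"
        unfolding isCont_def by (intro tendsto_intros)
      then have "\<forall>\<^sub>F x in at r. \<tau> < Re (w * power_series a (x * cis t))"
        using gt by (simp add: isCont_def order_tendstoD)
      then obtain d where d: "d > 0" "\<And>x. x \<noteq> r \<Longrightarrow> dist x r < d \<Longrightarrow> \<tau> < Re (w * power_series a (x * cis t))"
        by (auto simp: eventually_at)
      obtain q where q: "q \<in> \<rat>" "r < q" "q < min 1 (r + d)"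
        using Rats_dense_in_real[of r "min 1 (r + d)"] r d by auto
      then have "q \<in> D" using r by (auto simp: D_def)
      then obtain i where i: "rs i = q" using rsD unfolding rs_def by (metis imageE)
      have "\<tau> < Re (w * power_series a (q * cis t))" using q by (intro d) (auto simp: dist_real_def)
      also have "w * power_series a (q * cis t) = power_series (\<lambda>k. w * a k) (rs i * cis t)"
        using a q r i by (subst power_series_scale) (auto simp: norm_mult)
      finally have "t \<in> T w" using t by (auto simp: T_def)
      then show False using t w by blast
    qed
    let ?z = "power_series a (of_real r * cis t)"
    have "\<bar>Re ?z\<bar> \<le> \<tau>" "\<bar>Im ?z\<bar> \<le> \<tau>"
      using Re_le[of 1] Re_le[of "-1"] Re_le[of \<i>] Re_le[of "-\<i>"] by (auto simp: W_def abs_le_iff)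
    then show "cmod ?z \<le> 2 * \<tau>" using cmod_le[of ?z] by linarith
  qed
qed

section \<open>Radial limits of square summable power series\<close>

text \<open>
  The coefficients of \<open>f\<close> minus a partial sum of its power series.
\<close>
definition tail :: "nat \<Rightarrow> (nat \<Rightarrow> complex) \<Rightarrow> nat \<Rightarrow> complex" where
  "tail N a k = (if k < N then 0 else a k)"

lemma
  assumes "square_summable a"
  shows square_summable_tail: "square_summable (tail N a)"
    and tail_energy: "(\<Sum>k. (cmod (tail N a k))\<^sup>2) = (\<Sum>k. (cmod (a k))\<^sup>2) - (\<Sum>k<N. (cmod (a k))\<^sup>2)"
proof -
  have "(\<lambda>k. if k \<in> {..<N} then (cmod (a k))\<^sup>2 else 0) sums (\<Sum>k<N. (cmod (a k))\<^sup>2)"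
    by (rule sums_If_finite_set) simp
  from sums_diff[OF summable_sums[OF assms] this]
  have "(\<lambda>k. (cmod (tail N a k))\<^sup>2) sums ((\<Sum>k. (cmod (a k))\<^sup>2) - (\<Sum>k<N. (cmod (a k))\<^sup>2))"
    by (rule sums_cong[THEN iffD1, rotated]) (simp add: tail_def)
  then show "square_summable (tail N a)"
      "(\<Sum>k. (cmod (tail N a k))\<^sup>2) = (\<Sum>k. (cmod (a k))\<^sup>2) - (\<Sum>k<N. (cmod (a k))\<^sup>2)"
    by (simp_all add: sums_iff)
qed

lemma tail_energy_tendsto_0:
  assumes "square_summable a"
  shows "(\<lambda>N. \<Sum>k. (cmod (tail N a k))\<^sup>2) \<longlonglongrightarrow> 0"
  unfolding tail_energy[OF assms]
  using tendsto_diff[OF tendsto_const summable_LIMSEQ[OF assms], of "\<Sum>k. (cmod (a k))\<^sup>2"] by simp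

lemma power_series_split:
  assumes "square_summable a" "cmod z < 1"
  shows "power_series a z = (\<Sum>k<N. a k * z ^ k) + power_series (tail N a) z"
proof -
  have "(\<lambda>k. if k \<in> {..<N} then a k * z ^ k else 0) sums (\<Sum>k<N. a k * z ^ k)"
    by (rule sums_If_finite_set) simp
  from sums_add[OF this power_series_sums[OF square_summable_tail[OF assms(1)] assms(2)]]
  have "(\<lambda>k. a k * z ^ k) sums ((\<Sum>k<N. a k * z ^ k) + power_series (tail N a) z)"
    by (rule sums_cong[THEN iffD1, rotated]) (simp add: tail_def)
  then show ?thesis using power_series_sums[OF assms] sums_unique2 by blast
qed

text \<open>
  The partial sums of the series are continuous on the closed disk, so near the end of a radius the
  oscillation of \<open>f\<close> is, up to an arbitrarily small error, at most twice the maximal function of a tail. The tails have arbitrarily small energy,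
  hence by the weak-type inequality the points where the oscillation exceeds a given bound form a
  null set.
\<close>
theorem Fatou_radial_limit:
  assumes a: "square_summable a"
  shows "AE t in lborel. t \<in> {0..2*pi} \<longrightarrow>
    (\<exists>L. ((\<lambda>r. power_series a (of_real r * cis t)) \<longlongrightarrow> L) (at_left 1))"
proof -
  have small: "AE t in lborel. t \<in> {0..2*pi} \<longrightarrow> 
      (\<exists>N. \<forall>r. 0 \<le> r \<and> r < 1 \<longrightarrow> cmod (power_series (tail N a) (of_real r * cis t)) \<le> 2 / Suc j)" for j
  proof -
    have "\<exists>S. S \<in> sets borel \<and>
      emeasure lborel S \<le> ennreal (128 * pi * (\<Sum>k. (cmod (tail N a k))\<^sup>2) / (1 / Suc j)\<^sup>2) \<and>
      (\<forall>t r. t \<in> {0..2*pi} \<longrightarrow> t \<notin> S \<longrightarrow> 0 \<le> r \<longrightarrow> r < 1 \<longrightarrow> 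
        cmod (power_series (tail N a) (of_real r * cis t)) \<le> 2 * (1 / Suc j))" for N
    proof -
      have "0 < 1 / real (Suc j)" by simp
      from radial_maximal_weak_type[OF square_summable_tail[OF a] this] show ?thesis by metis
    qed
    then obtain S where S: "\<And>N. S N \<in> sets borel"
      "\<And>N. emeasure lborel (S N) \<le> ennreal (128 * pi * (\<Sum>k. (cmod (tail N a k))\<^sup>2) / (1 / Suc j)\<^sup>2)"
      "\<And>N t r. \<lbrakk>t \<in> {0..2*pi}; t \<notin> S N; 0 \<le> r; r < 1\<rbrakk> \<Longrightarrow>
        cmod (power_series (tail N a) (of_real r * cis t)) \<le> 2 * (1 / Suc j)"
      by metis
    have "(\<Inter>N. S N) \<in> null_sets lborel"
    proof (rule null_setsI)
      show "(\<Inter>N. S N) \<in> sets lborel" using S(1) by auto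
      have "(\<lambda>N. ennreal (128 * pi * (\<Sum>k. (cmod (tail N a k))\<^sup>2) / (1 / Suc j)\<^sup>2)) \<longlonglongrightarrow> 
          ennreal (128 * pi * 0 / (1 / Suc j)\<^sup>2)"
        by (intro tendsto_ennrealI tendsto_intros tail_energy_tendsto_0 a) simp
      moreover have "emeasure lborel (\<Inter>N. S N) \<le> 
          ennreal (128 * pi * (\<Sum>k. (cmod (tail N a k))\<^sup>2) / (1 / Suc j)\<^sup>2)" for N
        using S(1) by (intro order_trans[OF _ S(2)] emeasure_mono) auto
      ultimately have "emeasure lborel (\<Inter>N. S N) \<le> ennreal (128 * pi * 0 / (1 / Suc j)\<^sup>2)"
        by (intro LIMSEQ_le_const) auto
      then show "emeasure lborel (\<Inter>N. S N) = 0" by simp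
    qed
    then show ?thesis
    proof (rule AE_I', intro subsetI INT_I)
      fix t N
      assume "t \<in> {t \<in> space lborel. \<not> (t \<in> {0..2*pi} \<longrightarrow> (\<exists>N. \<forall>r. 0 \<le> r \<and> r < 1 \<longrightarrow>
        cmod (power_series (tail N a) (of_real r * cis t)) \<le> 2 / Suc j))}"
      then show "t \<in> S N" using S(3)[of t N] by auto
    qed
  qed
  then have "AE t in lborel. \<forall>j. t \<in> {0..2*pi} \<longrightarrow> 
      (\<exists>N. \<forall>r. 0 \<le> r \<and> r < 1 \<longrightarrow> cmod (power_series (tail N a) (of_real r * cis t)) \<le> 2 / Suc j)"
    unfolding AE_all_countable by blast
  then show ?thesis
  proof (rule AE_mp, intro AE_I2 impI)
    fix t :: real
    assume *: "\<forall>j. t \<in> {0..2*pi} \<longrightarrow> 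
      (\<exists>N. \<forall>r. 0 \<le> r \<and> r < 1 \<longrightarrow> cmod (power_series (tail N a) (of_real r * cis t)) \<le> 2 / Suc j)"
      and t: "t \<in> {0..2*pi}"
    let ?f = "\<lambda>r::real. power_series a (of_real r * cis t)"
    have "cauchy_filter (filtermap ?f (at_left 1))"
      unfolding cauchy_filter_metric_filtermap
    proof (intro allI impI)
      fix e :: real assume e: "0 < e"
      obtain j :: nat where j: "inverse (real (Suc j)) < e / 8" using reals_Archimedean[of "e / 8"] e by auto
      obtain N where N: "\<And>r. 0 \<le> r \<Longrightarrow> r < 1 \<Longrightarrow> cmod (power_series (tail N a) (of_real r * cis t)) \<le> 2 / Suc j"
        using * t by blast
      let ?p = "\<lambda>r::real. \<Sum>k<N. a k * (of_real r * cis t) ^ k"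
      have "(?p \<longlongrightarrow> ?p 1) (at_left 1)" by (intro tendsto_intros)
      then have ev1: "\<forall>\<^sub>F r in at_left 1. dist (?p r) (?p 1) < e / 4"
        by (rule tendstoD) (use e in simp)
      have ev2: "\<forall>\<^sub>F r in at_left (1::real). 0 \<le> r \<and> r < 1"
        by (auto simp: eventually_at_left_field intro: exI[of _ 0])
      show "\<exists>P. eventually P (at_left 1) \<and> (\<forall>x y. P x \<and> P y \<longrightarrow> dist (?f x) (?f y) < e)"
      proof (intro exI conjI allI impI)
        show "\<forall>\<^sub>F r in at_left 1. dist (?p r) (?p 1) < e / 4 \<and> 0 \<le> r \<and> r < 1"
          using eventually_conj[OF ev1 ev2] .
        fix x y :: real assume xy: "(dist (?p x) (?p 1) < e / 4 \<and> 0 \<le> x \<and> x < 1) \<and> dist (?p y) (?p 1) < e / 4 \<and> 0 \<le> y \<and> y < 1"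
        have near: "dist (?f r) (?p r) < e / 4" if "0 \<le> r" "r < 1" for r
        proof -
          have "?f r - ?p r = power_series (tail N a) (of_real r * cis t)"
            using that by (subst power_series_split[OF a, of _ N]) (auto simp: norm_mult)
          moreover have "2 / real (Suc j) < e / 4" using j by (simp add: inverse_eq_divide)
          ultimately show ?thesis using N[OF that] unfolding dist_norm by simp
        qed
        show "dist (?f x) (?f y) < e"
          using near[of x] near[of y] xy dist_triangle[of "?f x" "?f y" "?p x"]
            dist_triangle[of "?p x" "?f y" "?p 1"] dist_triangle[of "?p 1" "?f y" "?p y"]
          by (simp add: dist_commute)
      qed
    qed
    then obtain L where "filtermap ?f (at_left 1) \<le> nhds L"
      using cauchy_filter_complete_converges[OF _ complete_UNIV, of "filtermap ?f (at_left 1)"]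
      by (auto simp: filtermap_bot_iff)
    then show "\<exists>L. (?f \<longlongrightarrow> L) (at_left 1)" by (auto simp: filterlim_def)
  qed
qed

section \<open>Parseval's identity on the circle\<close>

abbreviation circle_measure :: "real measure" where
  "circle_measure \<equiv> arc_measure {0..2*pi}"

lemma borel_measurable_circle:
  "f \<in> borel_measurable borel \<Longrightarrow> f \<in> borel_measurable circle_measure"
  by (rule measurable_restrict_space1) simp

lemma trig_polynomial_energy:
  fixes b :: "nat \<Rightarrow> complex"
  shows "(LINT t|circle_measure. (cmod (\<Sum>k<N. b k * cis (real k * t)))\<^sup>2) = 2 * pi * (\<Sum>k<N. (cmod (b k))\<^sup>2)"
    and "integrable circle_measure (\<lambda>t. (cmod (\<Sum>k<N. b k * cis (real k * t)))\<^sup>2)"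
proof -
  interpret finite_measure circle_measure by (rule finite_arc_measure) auto
  have b: "cmod (\<Sum>k<N. b k * cis (real k * t)) \<le> (\<Sum>k<N. cmod (b k))" for t
    by (rule order_trans[OF norm_sum]) (simp add: norm_mult)
  show int: "integrable circle_measure (\<lambda>t. (cmod (\<Sum>k<N. b k * cis (real k * t)))\<^sup>2)"
    using b by (intro integrable_const_bound[of _ "(\<Sum>k<N. cmod (b k))\<^sup>2"]) (auto intro!: power_mono borel_measurable_circle)
  have eq: "of_real ((cmod (\<Sum>k<N. b k * cis (real k * t)))\<^sup>2) =
      (\<Sum>j<N. \<Sum>k<N. b j * cnj (b k) * cis (of_int (int j - int k) * t))" for t
  proof -
    have "of_real ((cmod (\<Sum>k<N. b k * cis (real k * t)))\<^sup>2) =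
      (\<Sum>j<N. b j * cis (real j * t)) * (\<Sum>k<N. cnj (b k) * cis (- real k * t))"
      unfolding complex_norm_square by (simp add: cis_cnj)
    also have "\<dots> = (\<Sum>j<N. \<Sum>k<N. b j * cnj (b k) * (cis (real j * t) * cis (- real k * t)))"
      by (simp add: sum_product mult_ac)
    finally show ?thesis by (simp add: cis_mult algebra_simps)
  qed
  have ii: "integrable circle_measure (\<lambda>t. b j * cnj (b k) * cis (of_int (int j - int k) * t))" for j k
    by (intro integrable_const_bound[of _ "cmod (b j * cnj (b k))"]) (auto simp: norm_mult intro!: borel_measurable_circle)
  have "of_real (LINT t|circle_measure. (cmod (\<Sum>k<N. b k * cis (real k * t)))\<^sup>2) =
      (LINT t|circle_measure. of_real ((cmod (\<Sum>k<N. b k * cis (real k * t)))\<^sup>2) :: complex)"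
    by (rule integral_of_real[OF int, symmetric])
  also have "\<dots> = (\<Sum>j<N. \<Sum>k<N. LINT t|circle_measure. b j * cnj (b k) * cis (of_int (int j - int k) * t))"
    unfolding eq using ii by (simp add: Bochner_Integration.integral_sum Bochner_Integration.integrable_sum)
  also have "\<dots> = (\<Sum>j<N. \<Sum>k<N. if j = k then 2 * pi * (b j * cnj (b j)) else 0)"
    unfolding integral_mult_right_zero integral_cis by (intro sum.cong) auto
  also have "\<dots> = of_real (2 * pi * (\<Sum>k<N. (cmod (b k))\<^sup>2))"
    unfolding of_real_mult of_real_sum complex_norm_square by (simp add: sum_distrib_left)
  finally show "(LINT t|circle_measure. (cmod (\<Sum>k<N. b k * cis (real k * t)))\<^sup>2) = 2 * pi * (\<Sum>k<N. (cmod (b k))\<^sup>2)"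
    by (simp only: of_real_eq_iff)
qed

text \<open>
  Fatou's lemma, in the form in which it transports a uniform energy bound to an almost everywhere
  limit.
\<close>
lemma energy_limit_le:
  fixes u :: "nat \<Rightarrow> 'a \<Rightarrow> complex"
  assumes "\<And>n. u n \<in> borel_measurable M" "v \<in> borel_measurable M"
    and "AE t in M. (\<lambda>n. u n t) \<longlonglongrightarrow> v t"
    and "\<And>n. (\<integral>\<^sup>+t. ennreal ((cmod (u n t))\<^sup>2) \<partial>M) \<le> C"
  shows "(\<integral>\<^sup>+t. ennreal ((cmod (v t))\<^sup>2) \<partial>M) \<le> C"
proof -
  have "(\<integral>\<^sup>+t. ennreal ((cmod (v t))\<^sup>2) \<partial>M) = (\<integral>\<^sup>+t. liminf (\<lambda>n. ennreal ((cmod (u n t))\<^sup>2)) \<partial>M)"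
  proof (rule nn_integral_cong_AE)
    show "AE t in M. ennreal ((cmod (v t))\<^sup>2) = liminf (\<lambda>n. ennreal ((cmod (u n t))\<^sup>2))"
      using assms(3)
    proof eventually_elim
      case (elim t)
      then have "(\<lambda>n. ennreal ((cmod (u n t))\<^sup>2)) \<longlonglongrightarrow> ennreal ((cmod (v t))\<^sup>2)"
        by (intro tendsto_ennrealI tendsto_intros)
      then show ?case by (intro lim_imp_Liminf[symmetric]) simp
    qed
  qed
  also have "\<dots> \<le> liminf (\<lambda>n. \<integral>\<^sup>+t. ennreal ((cmod (u n t))\<^sup>2) \<partial>M)"
    using assms(1) by (intro nn_integral_liminf) measurable
  also have "\<dots> \<le> C"
    using assms(4) by (intro Liminf_le) auto
  finally show ?thesis .
qed

lemma circle_energy_le: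
  assumes a: "square_summable a" and r: "0 \<le> r" "r < 1"
  shows "(\<integral>\<^sup>+t. ennreal ((cmod (power_series a (of_real r * cis t)))\<^sup>2) \<partial>circle_measure)
    \<le> ennreal (2 * pi * (\<Sum>k. (cmod (a k))\<^sup>2))"
proof (rule energy_limit_le[where u = "\<lambda>N t. \<Sum>k<N. a k * of_real (r ^ k) * cis (real k * t)"])
  show "AE t in circle_measure. (\<lambda>N. \<Sum>k<N. a k * of_real (r ^ k) * cis (real k * t))
      \<longlonglongrightarrow> power_series a (of_real r * cis t)"
  proof (rule AE_I2)
    fix t
    have "cmod (of_real r * cis t) < 1" using r by (simp add: norm_mult)
    from power_series_sums[OF a this]
    show "(\<lambda>N. \<Sum>k<N. a k * of_real (r ^ k) * cis (real k * t)) \<longlonglongrightarrow> power_series a (of_real r * cis t)"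
      by (simp add: sums_def power_mult_distrib Complex.DeMoivre mult.assoc)
  qed
  fix N
  have le: "(cmod (a k * of_real (r ^ k)))\<^sup>2 \<le> (cmod (a k))\<^sup>2" for k
    using r by (intro power_mono) (auto simp: norm_mult norm_power power_le_one mult_left_le)
  have "(\<integral>\<^sup>+t. ennreal ((cmod (\<Sum>k<N. a k * of_real (r ^ k) * cis (real k * t)))\<^sup>2) \<partial>circle_measure)
      = ennreal (2 * pi * (\<Sum>k<N. (cmod (a k * of_real (r ^ k)))\<^sup>2))"
    by (subst nn_integral_eq_integral) (use trig_polynomial_energy[where N = N and b = "\<lambda>k. a k * of_real (r ^ k)"] in auto)
  also have "\<dots> \<le> ennreal (2 * pi * (\<Sum>k. (cmod (a k))\<^sup>2))"
    using le sum_le_suminf[OF a, of "{..<N}"]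
    by (intro ennreal_leI mult_left_mono order_trans[OF sum_mono[OF le]]) auto
  finally show "(\<integral>\<^sup>+t. ennreal ((cmod (\<Sum>k<N. a k * of_real (r ^ k) * cis (real k * t)))\<^sup>2) \<partial>circle_measure)
     \<le> ennreal (2 * pi * (\<Sum>k. (cmod (a k))\<^sup>2))" .
qed (rule borel_measurable_circle; measurable)+

text \<open>
  Taking the limit along one fixed sequence of radii makes the function Borel measurable everywhere, even where no
  radial limit exists.
\<close>
definition boundary_series :: "(nat \<Rightarrow> complex) \<Rightarrow> real \<Rightarrow> complex" where
  "boundary_series a t = lim (\<lambda>n. power_series a (of_real (1 - 1 / Suc n) * cis t))"

lemma boundary_series_measurable [measurable]: "boundary_series a \<in> borel_measurable borel"
  unfolding boundary_series_def[abs_def] by measurable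

lemma radius_tendsto: "filterlim (\<lambda>n. 1 - 1 / real (Suc n)) (at_left 1) sequentially"
proof -
  have "(\<lambda>n. 1 - 1 / real (Suc n)) \<longlonglongrightarrow> 1 - 0"
    by (intro tendsto_intros LIMSEQ_Suc lim_1_over_n)
  then show ?thesis by (auto simp: filterlim_at)
qed

lemma boundary_series_eqI:
  assumes "((\<lambda>r. power_series a (of_real r * cis t)) \<longlongrightarrow> L) (at_left 1)"
  shows "boundary_series a t = L"
  unfolding boundary_series_def
  by (rule limI) (rule filterlim_compose[OF assms radius_tendsto])

lemma AE_boundary_series:
  assumes "square_summable a"
  shows "AE t in circle_measure. ((\<lambda>r. power_series a (of_real r * cis t)) \<longlongrightarrow> boundary_series a t) (at_left 1)"
proof -
  have "AE t in circle_measure. \<exists>L. ((\<lambda>r. power_series a (of_real r * cis t)) \<longlongrightarrow> L) (at_left 1)"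
    using Fatou_radial_limit[OF assms] by (simp add: AE_restrict_space_iff)
  then show ?thesis
    by eventually_elim (use boundary_series_eqI in blast)
qed

lemma boundary_energy_le:
  assumes a: "square_summable a"
  shows "integrable circle_measure (\<lambda>t. (cmod (boundary_series a t))\<^sup>2)"
    and "(LINT t|circle_measure. (cmod (boundary_series a t))\<^sup>2) \<le> 2 * pi * (\<Sum>k. (cmod (a k))\<^sup>2)"
proof -
  have le: "(\<integral>\<^sup>+t. ennreal ((cmod (boundary_series a t))\<^sup>2) \<partial>circle_measure)
      \<le> ennreal (2 * pi * (\<Sum>k. (cmod (a k))\<^sup>2))"
  proof (rule energy_limit_le[where u = "\<lambda>n t. power_series a (of_real (1 - 1 / Suc n) * cis t)"])
    show "AE t in circle_measure. (\<lambda>n. power_series a (of_real (1 - 1 / Suc n) * cis t)) \<longlonglongrightarrow> boundary_series a t"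
      using AE_boundary_series[OF a] by eventually_elim (rule filterlim_compose[OF _ radius_tendsto])
    show "(\<integral>\<^sup>+t. ennreal ((cmod (power_series a (of_real (1 - 1 / Suc n) * cis t)))\<^sup>2) \<partial>circle_measure)
      \<le> ennreal (2 * pi * (\<Sum>k. (cmod (a k))\<^sup>2))" for n
      by (rule circle_energy_le[OF a]) auto
  qed (rule borel_measurable_circle; measurable)+
  show int: "integrable circle_measure (\<lambda>t. (cmod (boundary_series a t))\<^sup>2)"
    using le by (intro integrableI_bounded borel_measurable_circle) (auto simp: less_top[symmetric] top_unique)
  have "ennreal (LINT t|circle_measure. (cmod (boundary_series a t))\<^sup>2) \<le> ennreal (2 * pi * (\<Sum>k. (cmod (a k))\<^sup>2))"
    using le by (subst nn_integral_eq_integral[symmetric]) (use int in auto)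
  moreover have "0 \<le> 2 * pi * (\<Sum>k. (cmod (a k))\<^sup>2)"
    using a by (intro mult_nonneg_nonneg suminf_nonneg) auto
  ultimately show "(LINT t|circle_measure. (cmod (boundary_series a t))\<^sup>2) \<le> 2 * pi * (\<Sum>k. (cmod (a k))\<^sup>2)"
    by simp
qed

lemma square_summable_lincomb:
  assumes "square_summable a" "square_summable b"
  shows "square_summable (\<lambda>k. a k + w * b k)"
proof (rule summable_comparison_test')
  show "summable (\<lambda>k. 2 * (cmod (a k))\<^sup>2 + 2 * (cmod w)\<^sup>2 * (cmod (b k))\<^sup>2)"
    using assms by (intro summable_add summable_mult)
  show "norm ((cmod (a k + w * b k))\<^sup>2) \<le> 2 * (cmod (a k))\<^sup>2 + 2 * (cmod w)\<^sup>2 * (cmod (b k))\<^sup>2" for k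
  proof -
    have "(cmod (a k + w * b k))\<^sup>2 \<le> (cmod (a k) + cmod (w * b k))\<^sup>2"
      by (intro power_mono norm_triangle_ineq) simp
    also have "\<dots> \<le> 2 * (cmod (a k))\<^sup>2 + 2 * (cmod (w * b k))\<^sup>2"
      using sum_squares_bound[of "cmod (a k)" "cmod (w * b k)"] by (simp add: power2_sum)
    finally show ?thesis by (simp add: norm_mult power_mult_distrib)
  qed
qed

lemma AE_boundary_series_lincomb:
  assumes a: "square_summable a" and b: "square_summable b"
  shows "AE t in circle_measure. boundary_series (\<lambda>k. a k + w * b k) t = boundary_series a t + w * boundary_series b t"
  using AE_boundary_series[OF a] AE_boundary_series[OF b]
proof eventually_elim
  case (elim t)
  have "((\<lambda>r. power_series a (of_real r * cis t) + w * power_series b (of_real r * cis t)) \<longlongrightarrow>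
      boundary_series a t + w * boundary_series b t) (at_left 1)"
    by (intro tendsto_intros elim)
  moreover have "\<forall>\<^sub>F r in at_left (1::real). power_series a (of_real r * cis t) + w * power_series b (of_real r * cis t)
      = power_series (\<lambda>k. a k + w * b k) (of_real r * cis t)"
  proof (rule eventually_at_leftI[of 0])
    fix r :: real assume "r \<in> {0<..<1}"
    then have z: "cmod (of_real r * cis t) < 1" by (simp add: norm_mult)
    have "(\<lambda>k. (a k + w * b k) * (of_real r * cis t) ^ k) sums
        (power_series a (of_real r * cis t) + w * power_series b (of_real r * cis t))"
      using sums_add[OF power_series_sums[OF a z] sums_mult[OF power_series_sums[OF b z], of w]]
      by (simp add: algebra_simps)
    then show "power_series a (of_real r * cis t) + w * power_series b (of_real r * cis t)
      = power_series (\<lambda>k. a k + w * b k) (of_real r * cis t)"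
      by (simp add: power_series_def sums_iff)
  qed simp
  ultimately have "((\<lambda>r. power_series (\<lambda>k. a k + w * b k) (of_real r * cis t)) \<longlongrightarrow>
      boundary_series a t + w * boundary_series b t) (at_left 1)"
    by (rule Lim_transform_eventually)
  then show ?case by (rule boundary_series_eqI)
qed

lemma AE_boundary_series_split:
  assumes a: "square_summable a"
  shows "AE t in circle_measure. boundary_series a t = (\<Sum>k<N. a k * cis (real k * t)) + boundary_series (tail N a) t"
  using AE_boundary_series[OF square_summable_tail[OF a, of N]]
proof eventually_elim
  case (elim t)
  have "((\<lambda>r. (\<Sum>k<N. a k * (of_real r * cis t) ^ k) + power_series (tail N a) (of_real r * cis t)) \<longlongrightarrow>
      (\<Sum>k<N. a k * (of_real 1 * cis t) ^ k) + boundary_series (tail N a) t) (at_left 1)"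
    by (intro tendsto_intros elim)
  moreover have "\<forall>\<^sub>F r in at_left (1::real).
      (\<Sum>k<N. a k * (of_real r * cis t) ^ k) + power_series (tail N a) (of_real r * cis t)
      = power_series a (of_real r * cis t)"
    by (rule eventually_at_leftI[of 0])
      (simp_all add: power_series_split[OF a, of _ N] norm_mult)
  ultimately have "((\<lambda>r. power_series a (of_real r * cis t)) \<longlongrightarrow>
      (\<Sum>k<N. a k * (of_real 1 * cis t) ^ k) + boundary_series (tail N a) t) (at_left 1)"
    by (rule Lim_transform_eventually)
  then show ?case by (simp add: boundary_series_eqI Complex.DeMoivre)
qed

lemma norm_square_le_weighted:
  assumes "0 < e"
  shows "(cmod (x + y))\<^sup>2 \<le> (1 + e) * (cmod x)\<^sup>2 + (1 + 1 / e) * (cmod y)\<^sup>2"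
proof -
  have "(cmod (x + y))\<^sup>2 \<le> (cmod x + cmod y)\<^sup>2"
    by (intro power_mono norm_triangle_ineq) simp
  also have "\<dots> \<le> (1 + e) * (cmod x)\<^sup>2 + (1 + 1 / e) * (cmod y)\<^sup>2"
  proof -
    have s: "sqrt e * sqrt e = e" using assms by simp
    have "0 \<le> (sqrt e * cmod x - cmod y / sqrt e)\<^sup>2" by simp
    also have "\<dots> = e * (cmod x)\<^sup>2 + (cmod y)\<^sup>2 / e - 2 * cmod x * cmod y"
      using assms by (simp add: power2_diff power_mult_distrib power_divide)
    finally show ?thesis by (simp add: power2_sum algebra_simps)
  qed
  finally show ?thesis .
qed

text \<open>
  One inequality is Fatou's lemma. For the other, a partial sum differs from the boundary function by
  the boundary function of a tail, whose energy is small by the first inequality.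
\<close>
theorem boundary_energy:
  assumes a: "square_summable a"
  shows "(LINT t|circle_measure. (cmod (boundary_series a t))\<^sup>2) = 2 * pi * (\<Sum>k. (cmod (a k))\<^sup>2)"
proof (rule antisym)
  let ?I = "LINT t|circle_measure. (cmod (boundary_series a t))\<^sup>2"
  let ?A = "\<Sum>k. (cmod (a k))\<^sup>2"
  show "?I \<le> 2 * pi * ?A" by (rule boundary_energy_le[OF a])
  have I0: "0 \<le> ?I" by (intro integral_nonneg_AE) auto
  have weighted: "2 * pi * ?A \<le> (1 + e) * ?I" if e: "0 < e" for e
  proof (rule LIMSEQ_le)
    show "(\<lambda>N. 2 * pi * (\<Sum>k<N. (cmod (a k))\<^sup>2)) \<longlonglongrightarrow> 2 * pi * ?A"
      by (intro tendsto_intros summable_LIMSEQ a)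
    have "(\<lambda>N. (1 + e) * ?I + (1 + 1 / e) * (2 * pi * (\<Sum>k. (cmod (tail N a k))\<^sup>2)))
        \<longlonglongrightarrow> (1 + e) * ?I + (1 + 1 / e) * (2 * pi * 0)"
      by (intro tendsto_intros tail_energy_tendsto_0 a)
    then show "(\<lambda>N. (1 + e) * ?I + (1 + 1 / e) * (2 * pi * (\<Sum>k. (cmod (tail N a k))\<^sup>2)))
        \<longlonglongrightarrow> (1 + e) * ?I" by simp
    have "2 * pi * (\<Sum>k<N. (cmod (a k))\<^sup>2)
        \<le> (1 + e) * ?I + (1 + 1 / e) * (2 * pi * (\<Sum>k. (cmod (tail N a k))\<^sup>2))" for N
    proof -
      note ta = square_summable_tail[OF a, of N]
      have "2 * pi * (\<Sum>k<N. (cmod (a k))\<^sup>2) = (LINT t|circle_measure. (cmod (\<Sum>k<N. a k * cis (real k * t)))\<^sup>2)"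
        by (rule trig_polynomial_energy(1)[symmetric])
      also have "\<dots> \<le> (LINT t|circle_measure. (1 + e) * (cmod (boundary_series a t))\<^sup>2
          + (1 + 1 / e) * (cmod (boundary_series (tail N a) t))\<^sup>2)"
      proof (rule integral_mono_AE[OF trig_polynomial_energy(2)])
        show "AE t in circle_measure. (cmod (\<Sum>k<N. a k * cis (real k * t)))\<^sup>2 \<le>
          (1 + e) * (cmod (boundary_series a t))\<^sup>2 + (1 + 1 / e) * (cmod (boundary_series (tail N a) t))\<^sup>2"
          using AE_boundary_series_split[OF a, of N]
        proof eventually_elim
          case (elim t)
          then have eq: "(\<Sum>k<N. a k * cis (real k * t)) = boundary_series a t + - boundary_series (tail N a) t" by simp
          show ?case unfolding eq using norm_square_le_weighted[OF e, of "boundary_series a t" "- boundary_series (tail N a) t"] by simp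
        qed
      qed (intro Bochner_Integration.integrable_add integrable_mult_right boundary_energy_le a ta)
      also have "\<dots> = (1 + e) * ?I + (1 + 1 / e) * (LINT t|circle_measure. (cmod (boundary_series (tail N a) t))\<^sup>2)"
        using boundary_energy_le(1)[OF a] boundary_energy_le(1)[OF ta] by simp
      also have "\<dots> \<le> (1 + e) * ?I + (1 + 1 / e) * (2 * pi * (\<Sum>k. (cmod (tail N a k))\<^sup>2))"
        using e boundary_energy_le(2)[OF ta] by (intro add_left_mono mult_left_mono) auto
      finally show ?thesis .
    qed
    then show "\<exists>M. \<forall>N\<ge>M. 2 * pi * (\<Sum>k<N. (cmod (a k))\<^sup>2)
        \<le> (1 + e) * ?I + (1 + 1 / e) * (2 * pi * (\<Sum>k. (cmod (tail N a k))\<^sup>2))" by blast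
  qed
  show "2 * pi * ?A \<le> ?I"
  proof (rule field_le_epsilon)
    fix d :: real assume d: "0 < d"
    have "2 * pi * ?A \<le> (1 + d / (1 + ?I)) * ?I" using d I0 by (intro weighted divide_pos_pos) linarith+
    also have "\<dots> = ?I + d * (?I / (1 + ?I))" by (simp add: algebra_simps)
    also have "\<dots> \<le> ?I + d * 1" using d I0 by (intro add_left_mono mult_left_mono divide_le_eq_1_pos[THEN iffD2]) linarith+
    finally show "2 * pi * ?A \<le> ?I + d" by simp
  qed
qed

lemma polarization:
  fixes x y :: complex
  shows "4 * (x * cnj y) = of_real ((cmod (x + 1 * y))\<^sup>2) - of_real ((cmod (x + (-1) * y))\<^sup>2)
    + \<i> * of_real ((cmod (x + \<i> * y))\<^sup>2) - \<i> * of_real ((cmod (x + (-\<i>) * y))\<^sup>2)"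
  by (simp add: complex_eq_iff cmod_power2) (simp add: power2_eq_square algebra_simps)


text \<open>
  Parseval's identity, obtained from \<open>boundary_energy\<close> by polarization.
\<close>
theorem boundary_inner:
  assumes a: "square_summable a" and b: "square_summable b"
  shows "integrable circle_measure (\<lambda>t. boundary_series a t * cnj (boundary_series b t))"
    and "summable (\<lambda>k. a k * cnj (b k))"
    and "(LINT t|circle_measure. boundary_series a t * cnj (boundary_series b t)) = 2 * pi * (\<Sum>k. a k * cnj (b k))"
proof -
  let ?A = "boundary_series a" and ?B = "boundary_series b"
  note ss = square_summable_lincomb[OF a b]
  have AE: "AE t in circle_measure. (cmod (boundary_series (\<lambda>k. a k + w * b k) t))\<^sup>2 = (cmod (?A t + w * ?B t))\<^sup>2" for w
    using AE_boundary_series_lincomb[OF a b, of w] by eventually_elim simp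
  have AE': "AE t in circle_measure. (cmod (?A t + w * ?B t))\<^sup>2 = (cmod (boundary_series (\<lambda>k. a k + w * b k) t))\<^sup>2" for w
    using AE[of w] by eventually_elim simp
  have int: "integrable circle_measure (\<lambda>t. (cmod (?A t + w * ?B t))\<^sup>2)" for w
  proof (rule integrable_cong_AE_imp[OF boundary_energy_le(1)[OF ss[of w]] _ AE[of w]])
    show "(\<lambda>t. (cmod (?A t + w * ?B t))\<^sup>2) \<in> borel_measurable circle_measure"
      by (rule borel_measurable_circle) measurable
  qed
  have I: "(LINT t|circle_measure. (cmod (?A t + w * ?B t))\<^sup>2) = 2 * pi * (\<Sum>k. (cmod (a k + w * b k))\<^sup>2)" for w
  proof -
    have "(LINT t|circle_measure. (cmod (?A t + w * ?B t))\<^sup>2) =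
        (LINT t|circle_measure. (cmod (boundary_series (\<lambda>k. a k + w * b k) t))\<^sup>2)"
    proof (rule integral_cong_AE[OF _ _ AE'])
      show "(\<lambda>t. (cmod (?A t + w * ?B t))\<^sup>2) \<in> borel_measurable circle_measure"
        by (rule borel_measurable_circle) measurable
      show "(\<lambda>t. (cmod (boundary_series (\<lambda>k. a k + w * b k) t))\<^sup>2) \<in> borel_measurable circle_measure"
        by (rule borel_measurable_circle) measurable
    qed
    then show ?thesis unfolding boundary_energy[OF ss] .
  qed
  define Q where "Q = (\<lambda>t w. complex_of_real ((cmod (?A t + w * ?B t))\<^sup>2))"
  have Qint: "integrable circle_measure (\<lambda>t. Q t w)" for w
    unfolding Q_def using int[of w] by (rule integrable_of_real)
  define q where "q = (\<lambda>w k. complex_of_real ((cmod (a k + w * b k))\<^sup>2))"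
  have QI: "(LINT t|circle_measure. Q t w) = 2 * pi * (\<Sum>k. q w k)" for w
    unfolding Q_def q_def integral_of_real[OF int] I
    using suminf_of_real[OF ss[of w], where ?'a = complex] by simp
  have eq: "?A t * cnj (?B t) = (1 / 4) * (Q t 1 - Q t (-1) + \<i> * Q t \<i> - \<i> * Q t (-\<i>))" for t
    unfolding Q_def polarization[symmetric] by simp
  show "integrable circle_measure (\<lambda>t. ?A t * cnj (?B t))"
    unfolding eq using Qint by (intro integrable_mult_right Bochner_Integration.integrable_add Bochner_Integration.integrable_diff)
  have qs: "q w sums (\<Sum>k. q w k)" for w
    unfolding q_def by (intro summable_sums summable_of_real ss)
  have eq': "a k * cnj (b k) = (1 / 4) * (q 1 k - q (-1) k + \<i> * q \<i> k - \<i> * q (-\<i>) k)" for k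
    unfolding q_def polarization[symmetric] by simp
  have sums: "(\<lambda>k. a k * cnj (b k)) sums
     ((1 / 4) * ((\<Sum>k. q 1 k) - (\<Sum>k. q (-1) k) + \<i> * (\<Sum>k. q \<i> k) - \<i> * (\<Sum>k. q (-\<i>) k)))"
    unfolding eq' by (intro sums_mult sums_add sums_diff qs)
  then show "summable (\<lambda>k. a k * cnj (b k))" by (rule sums_summable)
  have "(LINT t|circle_measure. ?A t * cnj (?B t)) =
    (1 / 4) * ((LINT t|circle_measure. Q t 1) - (LINT t|circle_measure. Q t (-1))
      + \<i> * (LINT t|circle_measure. Q t \<i>) - \<i> * (LINT t|circle_measure. Q t (-\<i>)))"
    unfolding eq using Qint by (simp add: Bochner_Integration.integral_diff Bochner_Integration.integral_add)
  also have "\<dots> = 2 * pi * (\<Sum>k. a k * cnj (b k))"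
    unfolding QI sums_unique[OF sums, symmetric] by (simp add: algebra_simps)
  finally show "(LINT t|circle_measure. ?A t * cnj (?B t)) = 2 * pi * (\<Sum>k. a k * cnj (b k))" .
qed

section \<open>The Hardy space as a sequence space\<close>

text \<open>
  Extension by zero matches the convention for elements of the Hardy space; the Hardy space is
  exactly the set of these functions for square summable coefficients.
\<close>
definition disk_series :: "(nat \<Rightarrow> complex) \<Rightarrow> complex \<Rightarrow> complex" where
  "disk_series a z = (if cmod z < 1 then power_series a z else 0)"

lemma fps_expansion_disk_series:
  assumes a: "square_summable a"
  shows "fps_expansion (disk_series a) 0 = Abs_fps a"
proof (rule fps_expansion_eqI)
  have "summable (\<lambda>k. a k * (1 / 2) ^ k)"
    using power_series_sums[OF a, of "1 / 2"] by (simp add: sums_iff)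
  then have "conv_radius a \<ge> norm (1 / 2 :: complex)" by (rule conv_radius_geI)
  then have "fps_conv_radius (Abs_fps a) \<ge> ereal (1 / 2)" by (simp add: fps_conv_radius_def)
  then have "fps_conv_radius (Abs_fps a) > 0"
    by (rule less_le_trans[rotated]) simp
  moreover have "\<forall>\<^sub>F z in nhds 0. eval_fps (Abs_fps a) z = disk_series a z"
  proof -
    have "\<forall>\<^sub>F z in nhds 0. z \<in> ball 0 (1::real)" by (rule eventually_nhds_in_open) auto
    then show ?thesis
      by (auto elim!: eventually_mono simp: eval_fps_def disk_series_def power_series_def)
  qed
  ultimately show "disk_series a has_fps_expansion Abs_fps a" by (simp add: has_fps_expansion_def)
qed

lemma disk_series_in_hardy [simp]:
  assumes a: "square_summable a"
  shows "disk_series a \<in> hardy_space"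
proof -
  have "disk_series a holomorphic_on ball 0 1"
    by (rule power_series_holomorphic[of _ _ a])
      (use power_series_sums[OF a] in \<open>simp add: disk_series_def\<close>)
  then show ?thesis
    using a by (simp add: hardy_space_def fps_expansion_disk_series disk_series_def)
qed

lemma hardy_space_cases:
  assumes "f \<in> hardy_space"
  obtains a where "square_summable a" "f = disk_series a"
proof
  let ?a = "fps_nth (fps_expansion f 0)"
  show "square_summable ?a" using assms by (simp add: hardy_space_def)
  have hol: "f holomorphic_on ball 0 1" and zero: "\<And>z. z \<notin> ball 0 1 \<Longrightarrow> f z = 0"
    using assms by (auto simp: hardy_space_def)
  have "f z = power_series ?a z" if "cmod z < 1" for z
    using holomorphic_power_series[OF hol, of z] that
    by (simp add: power_series_def fps_expansion_def sums_iff)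
  then show "f = disk_series ?a" using zero by (auto simp: disk_series_def fun_eq_iff)
qed

lemma disk_series_eqI:
  assumes "\<And>z. cmod z < 1 \<Longrightarrow> (\<lambda>k. a k * z ^ k) sums f z" "\<And>z. \<not> cmod z < 1 \<Longrightarrow> f z = 0"
  shows "f = disk_series a"
  using assms by (auto simp: fun_eq_iff disk_series_def power_series_def sums_iff)

lemma AE_circle_imp_lebesgue:
  assumes "AE t in circle_measure. P t"
  shows "AE t in lebesgue. t \<in> {0..2*pi} \<longrightarrow> P t"
  using assms by (intro AE_completion) (simp add: AE_restrict_space_iff)

lemma radial_limit_boundary_value:
  assumes "f \<in> hardy_space"
  shows "AE t in lebesgue. t \<in> {0..2*pi} \<longrightarrow>
    ((\<lambda>r. f (of_real r * cis t)) \<longlongrightarrow> boundary_value f t) (at_left 1)"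
proof -
  obtain a where a: "square_summable a" "f = disk_series a"
    using assms by (rule hardy_space_cases)
  have lim: "((\<lambda>r. f (of_real r * cis t)) \<longlongrightarrow> L) (at_left 1)"
    if "((\<lambda>r. power_series a (of_real r * cis t)) \<longlongrightarrow> L) (at_left 1)" for t L
  proof (rule Lim_transform_eventually[OF that])
    show "\<forall>\<^sub>F r in at_left (1::real). power_series a (of_real r * cis t) = f (of_real r * cis t)"
      by (rule eventually_at_leftI[of 0]) (auto simp: a(2) disk_series_def norm_mult)
  qed
  have "AE t in circle_measure. ((\<lambda>r. f (of_real r * cis t)) \<longlongrightarrow> boundary_value f t) (at_left 1)"
    using AE_boundary_series[OF a(1)]
  proof eventually_elim
    case (elim t)
    then have L: "((\<lambda>r. f (of_real r * cis t)) \<longlongrightarrow> boundary_series a t) (at_left 1)" by (rule lim)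
    then have "boundary_value f t = boundary_series a t"
      unfolding boundary_value_def by (intro tendsto_Lim) auto
    then show ?case using L by simp
  qed
  then show ?thesis by (rule AE_circle_imp_lebesgue)
qed

text \<open>
  Where a radial limit exists, the unspecified limit operator returns it; by Fatou's theorem this is the
  case almost everywhere.
\<close>
lemma boundary_value_disk_series:
  assumes a: "square_summable a"
  shows "AE t in lebesgue. t \<in> {0..2*pi} \<longrightarrow> boundary_value (disk_series a) t = boundary_series a t"
  using AE_circle_imp_lebesgue[OF AE_boundary_series[OF a]]
    radial_limit_boundary_value[OF disk_series_in_hardy[OF a]]
proof eventually_elim
  case (elim t)
  show ?case
  proof
    assume t: "t \<in> {0..2*pi}"
    have "((\<lambda>r. power_series a (of_real r * cis t)) \<longlongrightarrow> boundary_value (disk_series a) t) (at_left 1)"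
    proof (rule Lim_transform_eventually)
      show "((\<lambda>r. disk_series a (of_real r * cis t)) \<longlongrightarrow> boundary_value (disk_series a) t) (at_left 1)"
        using elim t by blast
      show "\<forall>\<^sub>F r in at_left (1::real). disk_series a (of_real r * cis t) = power_series a (of_real r * cis t)"
        by (rule eventually_at_leftI[of 0]) (auto simp: disk_series_def norm_mult)
    qed
    then show "boundary_value (disk_series a) t = boundary_series a t"
      by (rule boundary_series_eqI[symmetric])
  qed
qed

lemma hardy_integrand_disk_series:
  fixes a b
  assumes a: "square_summable a" and b: "square_summable b"
  defines "u \<equiv> \<lambda>t. indicator {0..2*pi} t *\<^sub>R (boundary_value (disk_series a) t * cnj (boundary_value (disk_series b) t))"
    and "v \<equiv> \<lambda>t. indicator {0..2*pi} t *\<^sub>R (boundary_series a t * cnj (boundary_series b t))"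
  shows "u \<in> borel_measurable lebesgue" "integral\<^sup>L lebesgue u = integral\<^sup>L lborel v"
proof -
  have vm: "v \<in> borel_measurable lborel" unfolding v_def by measurable
  have vm': "v \<in> borel_measurable lebesgue" using vm by (rule measurable_completion)
  have AE: "AE t in lebesgue. v t = u t"
    using boundary_value_disk_series[OF a] boundary_value_disk_series[OF b]
  proof eventually_elim
    case (elim t)
    then show ?case by (cases "t \<in> {0..2*pi}") (simp_all add: u_def v_def)
  qed
  show um: "u \<in> borel_measurable lebesgue" by (rule borel_measurable_AE[OF vm' AE])
  have "integral\<^sup>L lebesgue v = integral\<^sup>L lebesgue u" by (rule integral_cong_AE[OF vm' um AE])
  then show "integral\<^sup>L lebesgue u = integral\<^sup>L lborel v" using integral_completion[OF vm] by simp
qed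

theorem hardy_inner_disk_series:
  assumes a: "square_summable a" and b: "square_summable b"
  shows "hardy_inner (disk_series a) (disk_series b) = (\<Sum>k. a k * cnj (b k))"
proof -
  have "(LBINT t. indicator {0..2*pi} t *\<^sub>R (boundary_series a t * cnj (boundary_series b t)))
      = 2 * pi * (\<Sum>k. a k * cnj (b k))"
    using boundary_inner(3)[OF a b] by (simp add: integral_restrict_space)
  then show ?thesis
    unfolding hardy_inner_def set_lebesgue_integral_def hardy_integrand_disk_series(2)[OF a b] by simp
qed

lemma hardy_integrand_measurable:
  assumes "f \<in> hardy_space" "g \<in> hardy_space"
  shows "(\<lambda>t. indicator {0..2*pi} t *\<^sub>R (boundary_value f t * cnj (boundary_value g t))) \<in> borel_measurable lebesgue"
proof -
  obtain a where a: "square_summable a" "f = disk_series a" using assms(1) by (rule hardy_space_cases)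
  obtain b where b: "square_summable b" "g = disk_series b" using assms(2) by (rule hardy_space_cases)
  show ?thesis unfolding a(2) b(2) by (rule hardy_integrand_disk_series(1)[OF a(1) b(1)])
qed

lemma hardy_space_lincomb:
  assumes "f \<in> hardy_space" "g \<in> hardy_space"
  shows "(\<lambda>z. f z + w * g z) \<in> hardy_space"
    and "h \<in> hardy_space \<Longrightarrow> hardy_inner (\<lambda>z. f z + w * g z) h = hardy_inner f h + w * hardy_inner g h"
proof -
  obtain a where a: "square_summable a" "f = disk_series a" using assms(1) by (rule hardy_space_cases)
  obtain b where b: "square_summable b" "g = disk_series b" using assms(2) by (rule hardy_space_cases)
  have eq: "(\<lambda>z. f z + w * g z) = disk_series (\<lambda>k. a k + w * b k)"
  proof (rule disk_series_eqI)
    fix z :: complex assume z: "cmod z < 1"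
    show "(\<lambda>k. (a k + w * b k) * z ^ k) sums (f z + w * g z)"
      using sums_add[OF power_series_sums[OF a(1) z] sums_mult[OF power_series_sums[OF b(1) z], of w]] z
      by (simp add: a(2) b(2) disk_series_def algebra_simps)
  qed (simp add: a(2) b(2) disk_series_def)
  note ss = square_summable_lincomb[OF a(1) b(1), of w]
  show "(\<lambda>z. f z + w * g z) \<in> hardy_space" unfolding eq using ss by (rule disk_series_in_hardy)
  assume "h \<in> hardy_space"
  then obtain c where c: "square_summable c" "h = disk_series c" by (rule hardy_space_cases)
  have "(\<Sum>k. (a k + w * b k) * cnj (c k)) = (\<Sum>k. a k * cnj (c k)) + w * (\<Sum>k. b k * cnj (c k))"
    using sums_add[OF summable_sums[OF boundary_inner(2)[OF a(1) c(1)]]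
        sums_mult[OF summable_sums[OF boundary_inner(2)[OF b(1) c(1)]], of w]]
    by (simp add: sums_iff algebra_simps)
  then show "hardy_inner (\<lambda>z. f z + w * g z) h = hardy_inner f h + w * hardy_inner g h"
    unfolding eq unfolding c(2) a(2) b(2) hardy_inner_disk_series[OF ss c(1)]
      hardy_inner_disk_series[OF a(1) c(1)] hardy_inner_disk_series[OF b(1) c(1)] .
qed

lemma hardy_inner_commute: "hardy_inner g f = cnj (hardy_inner f g)"
  unfolding hardy_inner_def set_lebesgue_integral_def
  by (simp add: mult.commute flip: Bochner_Integration.integral_cnj)

lemma hardy_inner_self_eq_0:
  assumes "f \<in> hardy_space" "hardy_inner f f = 0"
  shows "f = (\<lambda>z. 0)"
proof -
  obtain a where a: "square_summable a" "f = disk_series a" using assms(1) by (rule hardy_space_cases)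
  have "complex_of_real (\<Sum>k. (cmod (a k))\<^sup>2) = (\<Sum>k. a k * cnj (a k))"
    unfolding complex_norm_square[symmetric] by (rule suminf_of_real[OF a(1)])
  also have "\<dots> = 0" using assms(2) hardy_inner_disk_series[OF a(1) a(1)] a(2) by simp
  finally have "(\<Sum>k. (cmod (a k))\<^sup>2) = 0" by simp
  then have "a k = 0" for k using suminf_eq_zero_iff[OF a(1)] by simp
  then show ?thesis by (simp add: a(2) disk_series_def power_series_def fun_eq_iff)
qed

lemma zero_in_hardy: "(\<lambda>z. 0) \<in> hardy_space"
proof -
  have "(\<lambda>z. 0) = disk_series (\<lambda>k. 0)" by (rule disk_series_eqI) auto
  then show ?thesis by simp
qed

lemma hardy_inner_zero_left [simp]: "hardy_inner (\<lambda>z. 0) g = 0"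
proof -
  have "boundary_value (\<lambda>z. 0) t = 0" for t
    unfolding boundary_value_def by (intro tendsto_Lim) auto
  then show ?thesis by (simp add: hardy_inner_def)
qed

lemma hardy_scale:
  assumes "f \<in> hardy_space"
  shows "(\<lambda>z. w * f z) \<in> hardy_space"
    and "h \<in> hardy_space \<Longrightarrow> hardy_inner (\<lambda>z. w * f z) h = w * hardy_inner f h"
  using hardy_space_lincomb[OF zero_in_hardy assms, where w = w] by simp_all

lemma hardy_diff:
  assumes "f \<in> hardy_space" "g \<in> hardy_space"
  shows "(\<lambda>z. f z - g z) \<in> hardy_space"
    and "h \<in> hardy_space \<Longrightarrow> hardy_inner (\<lambda>z. f z - g z) h = hardy_inner f h - hardy_inner g h"
  using hardy_space_lincomb[OF assms, where w = "-1"] by simp_all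

lemma hardy_sum:
  assumes "finite S" "\<And>i. i \<in> S \<Longrightarrow> f i \<in> hardy_space"
  shows "(\<lambda>z. \<Sum>i\<in>S. c i * f i z) \<in> hardy_space \<and>
    (\<forall>h\<in>hardy_space. hardy_inner (\<lambda>z. \<Sum>i\<in>S. c i * f i z) h = (\<Sum>i\<in>S. c i * hardy_inner (f i) h))"
  using assms
proof (induction S rule: finite_induct)
  case empty
  then show ?case by (simp add: zero_in_hardy)
next
  case (insert x S)
  then have "(\<lambda>z. \<Sum>i\<in>insert x S. c i * f i z) = (\<lambda>z. (\<Sum>i\<in>S. c i * f i z) + c x * f x z)"
    by (simp add: add.commute)
  then show ?case using insert hardy_space_lincomb[where f = "\<lambda>z. \<Sum>i\<in>S. c i * f i z" and g = "f x" and w = "c x"]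
    by (simp add: add.commute)
qed

section \<open>Multiplication by Blaschke factors and the reproducing kernel\<close>

lemma hardy_times_z:
  assumes "f \<in> hardy_space"
  shows "(\<lambda>z. z * f z) \<in> hardy_space"
proof -
  obtain a where a: "square_summable a" "f = disk_series a" using assms by (rule hardy_space_cases)
  define b where "b k = (case k of 0 \<Rightarrow> 0 | Suc j \<Rightarrow> a j)" for k
  have b: "square_summable b" using a(1) by (subst summable_Suc_iff[symmetric]) (simp add: b_def)
  have "(\<lambda>z. z * f z) = disk_series b"
  proof (rule disk_series_eqI)
    fix z :: complex assume z: "cmod z < 1"
    have "(\<lambda>k. b (Suc k) * z ^ Suc k) sums (z * f z)"
      using sums_mult[OF power_series_sums[OF a(1) z], of z] z
      by (simp add: b_def a(2) disk_series_def mult_ac)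
    then show "(\<lambda>k. b k * z ^ k) sums (z * f z)"
      by (subst (asm) sums_Suc_iff) (simp add: b_def)
  qed (simp add: a(2) disk_series_def)
  then show ?thesis using b by simp
qed

lemma one_minus_mult_nonzero:
  assumes "cmod l < 1" "cmod z \<le> 1"
  shows "1 - cnj l * z \<noteq> 0"
proof
  assume "1 - cnj l * z = 0"
  then have "1 = cmod l * cmod z" by (metis complex_mod_cnj norm_mult norm_one right_minus_eq)
  also have "\<dots> \<le> cmod l * 1" using assms by (intro mult_left_mono) auto
  finally show False using assms by simp
qed

text \<open>
  The coefficients of the quotient satisfy \<open>d\<^sub>k\<^sub>+\<^sub>1 = cnj l d\<^sub>k + a\<^sub>k\<^sub>+\<^sub>1\<close>. Splitting the square with a small weight
  keeps the factor in front of \<open>|d\<^sub>k|\<^sup>2\<close> below 1, so the partial sums of \<open>|d\<^sub>k|\<^sup>2\<close> are bounded.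
\<close>
lemma hardy_divide:
  assumes "f \<in> hardy_space" and l: "cmod l < 1"
  shows "(\<lambda>z. f z / (1 - cnj l * z)) \<in> hardy_space"
proof -
  obtain a where a: "square_summable a" "f = disk_series a" using assms(1) by (rule hardy_space_cases)
  define d where "d = rec_nat (a 0) (\<lambda>k x. cnj l * x + a (Suc k))"
  have d: "d 0 = a 0" "d (Suc k) = cnj l * d k + a (Suc k)" for k by (simp_all add: d_def)
  \<comment> \<open>The weight is chosen so that the contraction factor is at most the midpoint of \<open>|l|\<^sup>2\<close> and 1.\<close>
  define e where "e = (1 - (cmod l)\<^sup>2) / 2"
  define q where "q = (1 + (cmod l)\<^sup>2) / 2"
  have l2: "(cmod l)\<^sup>2 < 1" using l by (simp add: abs_square_less_1)
  have e: "0 < e" using l2 by (simp add: e_def)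
  have q: "(1 + e) * (cmod l)\<^sup>2 \<le> q" "q < 1" "0 \<le> q"
  proof -
    have "e * (cmod l)\<^sup>2 \<le> e * 1" using e l2 by (intro mult_left_mono) auto
    then show "(1 + e) * (cmod l)\<^sup>2 \<le> q" by (simp add: q_def e_def algebra_simps)
  qed (use l2 in \<open>simp_all add: q_def\<close>)
  let ?A = "\<Sum>k. (cmod (a k))\<^sup>2"
  have step: "(cmod (d (Suc k)))\<^sup>2 \<le> q * (cmod (d k))\<^sup>2 + (1 + 1 / e) * (cmod (a (Suc k)))\<^sup>2" for k
  proof -
    have "(cmod (d (Suc k)))\<^sup>2 \<le> (1 + e) * (cmod (cnj l * d k))\<^sup>2 + (1 + 1 / e) * (cmod (a (Suc k)))\<^sup>2"
      unfolding d by (rule norm_square_le_weighted[OF e])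
    also have "(1 + e) * (cmod (cnj l * d k))\<^sup>2 = ((1 + e) * (cmod l)\<^sup>2) * (cmod (d k))\<^sup>2"
      by (simp add: norm_mult power_mult_distrib)
    also have "\<dots> \<le> q * (cmod (d k))\<^sup>2" using q by (intro mult_right_mono) auto
    finally show ?thesis by simp
  qed
  have dd: "square_summable d"
  proof (rule summableI_nonneg_bounded)
    fix n
    let ?S = "\<Sum>k<n. (cmod (d k))\<^sup>2"
    have "?S \<le> (\<Sum>k<Suc n. (cmod (d k))\<^sup>2)" by (intro sum_mono2) auto
    also have "\<dots> = (cmod (a 0))\<^sup>2 + (\<Sum>k<n. (cmod (d (Suc k)))\<^sup>2)"
      unfolding sum.lessThan_Suc_shift d(1) ..
    also have "\<dots> \<le> (cmod (a 0))\<^sup>2 + (\<Sum>k<n. q * (cmod (d k))\<^sup>2 + (1 + 1 / e) * (cmod (a (Suc k)))\<^sup>2)"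
      by (intro add_left_mono sum_mono step)
    also have "\<dots> = (cmod (a 0))\<^sup>2 + q * ?S + (1 + 1 / e) * (\<Sum>k<n. (cmod (a (Suc k)))\<^sup>2)"
      by (simp add: sum.distrib sum_distrib_left)
    also have "(\<Sum>k<n. (cmod (a (Suc k)))\<^sup>2) \<le> ?A"
    proof -
      have "(\<Sum>k<n. (cmod (a (Suc k)))\<^sup>2) \<le> (\<Sum>k<Suc n. (cmod (a k))\<^sup>2)"
        unfolding sum.lessThan_Suc_shift by simp
      also have "\<dots> \<le> ?A" by (intro sum_le_suminf a) auto
      finally show ?thesis .
    qed
    finally have "?S \<le> (cmod (a 0))\<^sup>2 + q * ?S + (1 + 1 / e) * ?A" using e by (simp add: mult_left_mono)
    then show "?S \<le> ((cmod (a 0))\<^sup>2 + (1 + 1 / e) * ?A) / (1 - q)"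
      using q by (simp add: field_simps)
  qed simp
  have "(\<lambda>z. f z / (1 - cnj l * z)) = disk_series d"
  proof (rule disk_series_eqI)
    fix z :: complex assume z: "cmod z < 1"
    let ?D = "power_series d z"
    have "(\<lambda>k. d (Suc k) * z ^ Suc k) sums (?D - a 0)"
      using power_series_sums[OF dd z] by (subst sums_Suc_iff) (simp add: d)
    moreover have "(\<lambda>k. a (Suc k) * z ^ Suc k) sums (f z - a 0)"
      using power_series_sums[OF a(1) z] z by (subst sums_Suc_iff) (simp add: a(2) disk_series_def)
    then have "(\<lambda>k. cnj l * z * (d k * z ^ k) + a (Suc k) * z ^ Suc k) sums (cnj l * z * ?D + (f z - a 0))"
      by (intro sums_add sums_mult power_series_sums[OF dd z])
    then have "(\<lambda>k. d (Suc k) * z ^ Suc k) sums (cnj l * z * ?D + (f z - a 0))"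
      by (simp add: d algebra_simps)
    ultimately have "?D - a 0 = cnj l * z * ?D + (f z - a 0)" by (rule sums_unique2)
    then have "?D * (1 - cnj l * z) = f z" by (simp add: algebra_simps)
    then have "f z / (1 - cnj l * z) = ?D" using one_minus_mult_nonzero[OF l, of z] z by (simp add: field_simps)
    then show "(\<lambda>k. d k * z ^ k) sums (f z / (1 - cnj l * z))" using power_series_sums[OF dd z] by simp
  qed (simp add: a(2) disk_series_def)
  then show ?thesis using dd by simp
qed

definition szego_kernel :: "complex \<Rightarrow> complex \<Rightarrow> complex" where
  "szego_kernel l z = (if cmod z < 1 then 1 / (1 - cnj l * z) else 0)"

lemma szego_kernel_reproducing:
  assumes l: "cmod l < 1"
  shows "szego_kernel l \<in> hardy_space"
    and "f \<in> hardy_space \<Longrightarrow> hardy_inner f (szego_kernel l) = f l"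
proof -
  have ss: "square_summable (\<lambda>k. cnj l ^ k)"
  proof -
    have "(cmod l)\<^sup>2 < 1" using l by (simp add: abs_square_less_1)
    then have "summable (\<lambda>k. ((cmod l)\<^sup>2) ^ k)" by (intro summable_geometric) simp
    then show ?thesis by (simp add: norm_power power_mult[symmetric] mult.commute)
  qed
  have eq: "szego_kernel l = disk_series (\<lambda>k. cnj l ^ k)"
  proof (rule disk_series_eqI)
    fix z :: complex assume z: "cmod z < 1"
    have "cmod (cnj l * z) < 1" using mult_strict_mono'[OF l z] by (simp add: norm_mult)
    then show "(\<lambda>k. cnj l ^ k * z ^ k) sums szego_kernel l z"
      using geometric_sums[of "cnj l * z"] z by (simp add: szego_kernel_def power_mult_distrib)
  qed (simp add: szego_kernel_def)
  show "szego_kernel l \<in> hardy_space" unfolding eq using ss by (rule disk_series_in_hardy)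
  assume "f \<in> hardy_space"
  then obtain a where a: "square_summable a" "f = disk_series a" by (rule hardy_space_cases)
  show "hardy_inner f (szego_kernel l) = f l"
    unfolding eq a(2) hardy_inner_disk_series[OF a(1) ss] using l by (simp add: disk_series_def power_series_def)
qed

definition blaschke_factor :: "complex \<Rightarrow> complex \<Rightarrow> complex" where
  "blaschke_factor l z = (z - l) / (1 - cnj l * z)"

lemma hardy_blaschke_factor:
  assumes f: "f \<in> hardy_space" and l: "cmod l < 1"
  shows "(\<lambda>z. blaschke_factor l z * f z) \<in> hardy_space"
proof -
  have "(\<lambda>z. (z * f z + (- l) * f z) / (1 - cnj l * z)) \<in> hardy_space"
    by (intro hardy_divide hardy_space_lincomb hardy_times_z f l)
  then show ?thesis by (simp add: blaschke_factor_def algebra_simps)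
qed

lemma norm_blaschke_factor_cis:
  assumes l: "cmod l < 1"
  shows "cmod (blaschke_factor l (cis t)) = 1"
proof -
  have "cis t - l = cis t * cnj (1 - cnj l * cis t)"
    by (simp add: algebra_simps cis_cnj cis_mult)
  then have "cmod (cis t - l) = cmod (1 - cnj l * cis t)"
    by (metis complex_mod_cnj mult_1 norm_cis norm_mult)
  then show ?thesis
    using one_minus_mult_nonzero[OF l, of "cis t"] by (simp add: blaschke_factor_def norm_divide)
qed

text \<open>
  The factor is continuous up to the circle and unimodular there, so the two boundary integrands agree
  almost everywhere.
\<close>
lemma hardy_inner_blaschke_factor:
  assumes f: "f \<in> hardy_space" and g: "g \<in> hardy_space" and l: "cmod l < 1"
  shows "hardy_inner (\<lambda>z. blaschke_factor l z * f z) (\<lambda>z. blaschke_factor l z * g z) = hardy_inner f g"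
proof -
  have bv: "AE t in lebesgue. t \<in> {0..2*pi} \<longrightarrow>
      boundary_value (\<lambda>z. blaschke_factor l z * h z) t = blaschke_factor l (cis t) * boundary_value h t"
    if h: "h \<in> hardy_space" for h
    using radial_limit_boundary_value[OF h]
  proof eventually_elim
    case (elim t)
    show ?case
    proof
      assume "t \<in> {0..2*pi}"
      then have lim: "((\<lambda>r. h (of_real r * cis t)) \<longlongrightarrow> boundary_value h t) (at_left 1)" using elim by blast
      have "((\<lambda>r. blaschke_factor l (of_real r * cis t)) \<longlongrightarrow> blaschke_factor l (of_real 1 * cis t)) (at_left 1)"
        unfolding blaschke_factor_def
        by (intro tendsto_intros) (use one_minus_mult_nonzero[OF l, of "cis t"] in simp)
      from tendsto_mult[OF this lim] show
        "boundary_value (\<lambda>z. blaschke_factor l z * h z) t = blaschke_factor l (cis t) * boundary_value h t"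
        unfolding boundary_value_def[of "\<lambda>z. blaschke_factor l z * h z"] by (intro tendsto_Lim) auto
    qed
  qed
  have unit: "blaschke_factor l (cis t) * cnj (blaschke_factor l (cis t)) = 1" for t
    using norm_blaschke_factor_cis[OF l, of t] by (simp only: complex_norm_square[symmetric]) simp
  have "AE t in lebesgue. indicator {0..2*pi} t *\<^sub>R (boundary_value (\<lambda>z. blaschke_factor l z * f z) t
        * cnj (boundary_value (\<lambda>z. blaschke_factor l z * g z) t))
      = indicator {0..2*pi} t *\<^sub>R (boundary_value f t * cnj (boundary_value g t))"
    using bv[OF f] bv[OF g]
  proof eventually_elim
    case (elim t)
    have "(blaschke_factor l (cis t) * boundary_value f t) * cnj (blaschke_factor l (cis t) * boundary_value g t)
      = (blaschke_factor l (cis t) * cnj (blaschke_factor l (cis t))) * (boundary_value f t * cnj (boundary_value g t))"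
      by (simp only: complex_cnj_mult mult_ac)
    then have "(blaschke_factor l (cis t) * boundary_value f t) * cnj (blaschke_factor l (cis t) * boundary_value g t)
      = boundary_value f t * cnj (boundary_value g t)"
      unfolding unit by simp
    then show ?case using elim by (cases "t \<in> {0..2*pi}") simp_all
  qed
  then have "(LINT t|lebesgue. indicator {0..2*pi} t *\<^sub>R (boundary_value (\<lambda>z. blaschke_factor l z * f z) t
        * cnj (boundary_value (\<lambda>z. blaschke_factor l z * g z) t)))
      = (LINT t|lebesgue. indicator {0..2*pi} t *\<^sub>R (boundary_value f t * cnj (boundary_value g t)))"
    by (intro integral_cong_AE hardy_integrand_measurable hardy_blaschke_factor f g l)
  then show ?thesis by (simp add: hardy_inner_def set_lebesgue_integral_def)
qed

lemma hardy_blaschke_prod: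
  assumes "finite S" "\<And>i. i \<in> S \<Longrightarrow> cmod (lam i) < 1" "f \<in> hardy_space"
  shows "(\<lambda>z. (\<Prod>i\<in>S. blaschke_factor (lam i) z) * f z) \<in> hardy_space"
  using assms
proof (induction S rule: finite_induct)
  case (insert x S)
  then have "(\<lambda>z. blaschke_factor (lam x) z * ((\<Prod>i\<in>S. blaschke_factor (lam i) z) * f z)) \<in> hardy_space"
    by (intro hardy_blaschke_factor) auto
  then show ?case using insert by (simp add: mult.assoc)
qed simp

lemma hardy_inner_blaschke_prod:
  assumes "finite S" "\<And>i. i \<in> S \<Longrightarrow> cmod (lam i) < 1" "f \<in> hardy_space" "g \<in> hardy_space"
  shows "hardy_inner (\<lambda>z. (\<Prod>i\<in>S. blaschke_factor (lam i) z) * f z)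
    (\<lambda>z. (\<Prod>i\<in>S. blaschke_factor (lam i) z) * g z) = hardy_inner f g"
  using assms
proof (induction S rule: finite_induct)
  case (insert x S)
  have "hardy_inner (\<lambda>z. blaschke_factor (lam x) z * ((\<Prod>i\<in>S. blaschke_factor (lam i) z) * f z))
      (\<lambda>z. blaschke_factor (lam x) z * ((\<Prod>i\<in>S. blaschke_factor (lam i) z) * g z)) = hardy_inner f g"
    using insert by (subst hardy_inner_blaschke_factor) (auto intro: hardy_blaschke_prod)
  then show ?case using insert by (simp add: mult.assoc)
qed simp

text \<open>
  The definite description in the projection has a unique solution because the inner product is
  definite on the Hardy space.
\<close>
lemma hardy_proj_eqI:
  assumes V: "V \<subseteq> hardy_space" "\<And>g h. g \<in> V \<Longrightarrow> h \<in> V \<Longrightarrow> (\<lambda>z. g z - h z) \<in> V"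
    and g: "g \<in> V" "(\<lambda>z. f z - g z) \<in> hardy_orth V"
  shows "hardy_proj V f = g"
  unfolding hardy_proj_def
proof (rule the_equality)
  show "g \<in> V \<and> (\<lambda>z. f z - g z) \<in> hardy_orth V" using g by blast
  fix h assume h: "h \<in> V \<and> (\<lambda>z. f z - h z) \<in> hardy_orth V"
  let ?d = "\<lambda>z. g z - h z"
  have d: "?d \<in> V" using V g h by blast
  have "hardy_inner (\<lambda>z. (f z - h z) - (f z - g z)) ?d =
      hardy_inner (\<lambda>z. f z - h z) ?d - hardy_inner (\<lambda>z. f z - g z) ?d"
    using g h d V by (intro hardy_diff(2)) (auto simp: hardy_orth_def)
  also have "\<dots> = 0" using g h d by (simp add: hardy_orth_def)
  finally have "hardy_inner ?d ?d = 0" by simp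
  then have "?d = (\<lambda>z. 0)" using d V by (intro hardy_inner_self_eq_0) auto
  then show "h = g" by (simp add: fun_eq_iff)
qed

section \<open>The Malmquist-Walsh basis and the model operator\<close>

lemma malmquist_walsh_eq:
  "malmquist_walsh lam k = (\<lambda>z. (\<Prod>i\<in>{1..<k}. blaschke_factor (lam i) z) *
     (of_real (sqrt (1 - (cmod (lam k))\<^sup>2)) * szego_kernel (lam k) z))"
  by (auto simp: fun_eq_iff malmquist_walsh_def szego_kernel_def blaschke_factor_def)

lemma malmquist_walsh_in_hardy:
  assumes "\<And>i. i \<in> {1..k} \<Longrightarrow> cmod (lam i) < 1" "1 \<le> k"
  shows "malmquist_walsh lam k \<in> hardy_space"
  unfolding malmquist_walsh_eq
  using assms by (intro hardy_blaschke_prod hardy_scale szego_kernel_reproducing) auto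

text \<open>
  The isometry cancels the first \<open>i - 1\<close> factors and leaves a value at \<open>\<lambda>\<^sub>i\<close> of a multiple of the
  \<open>i\<close>-th factor. For \<open>m = n\<close> it shows that \<open>e\<^sub>i\<close> is in the model space; for
  \<open>m < n\<close> it gives the orthogonality of \<open>e\<^sub>i\<close> and \<open>e\<^sub>m\<^sub>+\<^sub>1\<close>.
\<close>
lemma blaschke_multiple_orth_malmquist_walsh:
  assumes lam: "\<And>k. k \<in> {1..m} \<Longrightarrow> cmod (lam k) < 1" and i: "1 \<le> i" "i \<le> m" and h: "h \<in> hardy_space"
  shows "hardy_inner (\<lambda>z. (\<Prod>k\<in>{1..m}. blaschke_factor (lam k) z) * h z) (malmquist_walsh lam i) = 0"
proof -
  let ?c = "complex_of_real (sqrt (1 - (cmod (lam i))\<^sup>2))"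
  let ?f = "\<lambda>z. (\<Prod>k\<in>{i..m}. blaschke_factor (lam k) z) * h z"
  have li: "cmod (lam i) < 1" using lam i by auto
  have f: "?f \<in> hardy_space" using lam i h by (intro hardy_blaschke_prod) auto
  note K = szego_kernel_reproducing[OF li]
  have "(\<Prod>k\<in>{1..m}. blaschke_factor (lam k) z) =
      (\<Prod>k\<in>{1..<i}. blaschke_factor (lam k) z) * (\<Prod>k\<in>{i..m}. blaschke_factor (lam k) z)" for z
    using i by (subst prod.union_disjoint[symmetric]) (auto intro!: prod.cong)
  then have "hardy_inner (\<lambda>z. (\<Prod>k\<in>{1..m}. blaschke_factor (lam k) z) * h z) (malmquist_walsh lam i)
     = hardy_inner (\<lambda>z. (\<Prod>k\<in>{1..<i}. blaschke_factor (lam k) z) * ?f z) (malmquist_walsh lam i)"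
    by (simp add: mult.assoc)
  also have "\<dots> = hardy_inner ?f (\<lambda>z. ?c * szego_kernel (lam i) z)"
    unfolding malmquist_walsh_eq
    by (rule hardy_inner_blaschke_prod) (use lam i f K in \<open>auto intro: hardy_scale\<close>)
  also have "\<dots> = cnj (?c * cnj (?f (lam i)))"
    by (subst hardy_inner_commute) (simp only: hardy_scale(2)[OF K(1) f] hardy_inner_commute[of "szego_kernel (lam i)"] K(2)[OF f])
  also have "?f (lam i) = 0"
    using i by (simp add: blaschke_factor_def) (force intro!: prod_zero)
  finally show ?thesis by simp
qed

lemma malmquist_walsh_orthonormal:
  assumes lam: "\<And>k. k \<in> {1..n} \<Longrightarrow> cmod (lam k) < 1" and ij: "i \<in> {1..n}" "j \<in> {1..n}"
  shows "hardy_inner (malmquist_walsh lam j) (malmquist_walsh lam i) = (if i = j then 1 else 0)"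
proof -
  have less: "hardy_inner (malmquist_walsh lam q) (malmquist_walsh lam p) = 0"
    if "1 \<le> p" "p < q" "q \<le> n" for p q
  proof -
    have Iv: "{1..<q} = {1..q - 1}" using that by auto
    show ?thesis unfolding malmquist_walsh_eq[of lam q] Iv
      using that lam
      by (intro blaschke_multiple_orth_malmquist_walsh hardy_scale szego_kernel_reproducing) auto
  qed
  have eq: "hardy_inner (malmquist_walsh lam i) (malmquist_walsh lam i) = 1"
  proof -
    let ?c = "complex_of_real (sqrt (1 - (cmod (lam i))\<^sup>2))"
    have li: "cmod (lam i) < 1" using lam ij by auto
    then have l2: "(cmod (lam i))\<^sup>2 < 1" by (simp add: abs_square_less_1)
    note K = szego_kernel_reproducing[OF li]
    note cK = hardy_scale(1)[OF K(1), of ?c]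
    have "hardy_inner (malmquist_walsh lam i) (malmquist_walsh lam i) =
        hardy_inner (\<lambda>z. ?c * szego_kernel (lam i) z) (\<lambda>z. ?c * szego_kernel (lam i) z)"
      unfolding malmquist_walsh_eq using ij lam cK by (intro hardy_inner_blaschke_prod) auto
    also have "\<dots> = ?c * cnj (?c * szego_kernel (lam i) (lam i))"
      by (simp only: hardy_scale(2)[OF K(1) cK] hardy_inner_commute[of "szego_kernel (lam i)"] K(2)[OF cK])
    also have "\<dots> = of_real ((sqrt (1 - (cmod (lam i))\<^sup>2))\<^sup>2 / (1 - (cmod (lam i))\<^sup>2))"
      using li unfolding szego_kernel_def
      by (simp add: power2_eq_square complex_norm_square[symmetric] mult.commute[of "cnj _"] del: real_sqrt_mult_self)
    also have "\<dots> = 1" using l2 by simp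
    finally show ?thesis .
  qed
  show ?thesis
  proof (cases i j rule: linorder_cases)
    case greater
    then show ?thesis using less[of j i] ij by (subst hardy_inner_commute) auto
  qed (use less[of i j] eq ij in auto)
qed

text \<open>
  The Szego kernel at 0 is the constant 1 on the disk, extended by zero.
\<close>
definition blaschke_partial :: "(nat \<Rightarrow> complex) \<Rightarrow> nat \<Rightarrow> complex \<Rightarrow> complex" where
  "blaschke_partial lam j z = (\<Prod>k\<in>{1..j}. blaschke_factor (lam k) z) * szego_kernel 0 z"

text \<open>
  This is \<open>1 = (1 - |l|\<^sup>2) / (1 - cnj l z) - cnj l (z - l) / (1 - cnj l z)\<close> multiplied by the
  first \<open>m\<close> Blaschke factors.
\<close>
lemma blaschke_partial_Suc:
  assumes "cmod (lam (Suc m)) < 1"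
  shows "blaschke_partial lam m z = of_real (sqrt (1 - (cmod (lam (Suc m)))\<^sup>2)) * malmquist_walsh lam (Suc m) z
    - cnj (lam (Suc m)) * blaschke_partial lam (Suc m) z"
proof (cases "cmod z < 1")
  case True
  let ?l = "lam (Suc m)"
  let ?P = "\<Prod>k\<in>{1..m}. blaschke_factor (lam k) z"
  have nz: "1 - cnj ?l * z \<noteq> 0" using one_minus_mult_nonzero[OF assms] True by simp
  have l2: "(cmod ?l)\<^sup>2 < 1" using assms by (simp add: abs_square_less_1)
  have c: "of_real (sqrt (1 - (cmod ?l)\<^sup>2)) * of_real (sqrt (1 - (cmod ?l)\<^sup>2)) = 1 - ?l * cnj ?l"
  proof -
    have "of_real (sqrt (1 - (cmod ?l)\<^sup>2)) * of_real (sqrt (1 - (cmod ?l)\<^sup>2)) = complex_of_real (1 - (cmod ?l)\<^sup>2)"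
      using l2 by (simp flip: of_real_mult)
    then show ?thesis unfolding of_real_diff complex_norm_square by simp
  qed
  have "1 = (1 - ?l * cnj ?l) / (1 - cnj ?l * z) - cnj ?l * ((z - ?l) / (1 - cnj ?l * z))"
    using nz by (simp add: field_simps)
  then have "?P = ?P * ((1 - ?l * cnj ?l) / (1 - cnj ?l * z) - cnj ?l * blaschke_factor ?l z)"
    by (simp add: blaschke_factor_def)
  also have "\<dots> = of_real (sqrt (1 - (cmod ?l)\<^sup>2)) * malmquist_walsh lam (Suc m) z - cnj ?l * blaschke_partial lam (Suc m) z"
    using True unfolding c[symmetric] malmquist_walsh_eq blaschke_partial_def
    by (simp add: szego_kernel_def algebra_simps atLeastLessThanSuc_atLeastAtMost)
  finally show ?thesis using True by (simp add: blaschke_partial_def szego_kernel_def)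
qed (simp add: blaschke_partial_def szego_kernel_def malmquist_walsh_eq)

lemma blaschke_partial_expansion:
  assumes "j \<le> n" "\<And>k. k \<in> {1..n} \<Longrightarrow> cmod (lam k) < 1"
  shows "blaschke_partial lam j z =
    (\<Sum>i\<in>{j+1..n}. of_real (sqrt (1 - (cmod (lam i))\<^sup>2)) * (\<Prod>\<mu>\<in>{j+1..i-1}. - cnj (lam \<mu>)) * malmquist_walsh lam i z)
    + (\<Prod>\<mu>\<in>{j+1..n}. - cnj (lam \<mu>)) * blaschke_partial lam n z"
  using assms
proof (induction n rule: dec_induct)
  case (step m)
  have IH: "blaschke_partial lam j z =
    (\<Sum>i\<in>{j+1..m}. of_real (sqrt (1 - (cmod (lam i))\<^sup>2)) * (\<Prod>\<mu>\<in>{j+1..i-1}. - cnj (lam \<mu>)) * malmquist_walsh lam i z)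
    + (\<Prod>\<mu>\<in>{j+1..m}. - cnj (lam \<mu>)) * blaschke_partial lam m z"
    using step by auto
  have l: "cmod (lam (Suc m)) < 1" using step by auto
  show ?case unfolding IH blaschke_partial_Suc[of lam m z, OF l]
    using step(1) by (simp add: algebra_simps)
qed simp

text \<open>
  Write \<open>z = (z - \<lambda>\<^sub>j) + \<lambda>\<^sub>j\<close>; the first summand turns the kernel into the \<open>j\<close>-th Blaschke factor.
\<close>
lemma times_z_malmquist_walsh:
  assumes "1 \<le> j" "cmod (lam j) < 1"
  shows "z * malmquist_walsh lam j z = lam j * malmquist_walsh lam j z
    + of_real (sqrt (1 - (cmod (lam j))\<^sup>2)) * blaschke_partial lam j z"
proof (cases "cmod z < 1")
  case True
  have "{1..j} = insert j {1..<j}" using assms by auto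
  then show ?thesis using True
    by (simp add: malmquist_walsh_eq blaschke_partial_def szego_kernel_def blaschke_factor_def algebra_simps diff_divide_distrib)
qed (simp add: blaschke_partial_def szego_kernel_def malmquist_walsh_eq)

text \<open>
  The column \<open>g\<close> is checked to be the projection of \<open>z e\<^sub>j\<close>: it is in the model space, and the remainder
  is a multiple of the Blaschke product.
\<close>
theorem model_operator_matrix:
  assumes lam: "\<And>k. k \<in> {1..n} \<Longrightarrow> cmod (lam k) < 1" and i: "i \<in> {1..n}" and j: "j \<in> {1..n}"
  shows "matrix_entry (model_operator (blaschke lam n)) (malmquist_walsh lam) i j =
      (if i < j then 0
       else if i = j then lam i
       else of_real (sqrt (1 - (cmod (lam i))\<^sup>2)) * of_real (sqrt (1 - (cmod (lam j))\<^sup>2))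
              * (\<Prod>\<mu>=j+1..i-1. - cnj (lam \<mu>)))"
proof -
  define s where "s i = complex_of_real (sqrt (1 - (cmod (lam i))\<^sup>2))" for i
  define M where "M i = (if i < j then 0 else if i = j then lam i
       else s i * s j * (\<Prod>\<mu>=j+1..i-1. - cnj (lam \<mu>)))" for i
  define e where "e = malmquist_walsh lam"
  define B where "B = blaschke lam n"
  define V where "V = model_space B"
  define g where "g = (\<lambda>z. \<Sum>i\<in>{1..n}. M i * e i z)"
  have B: "B = (\<lambda>z. \<Prod>k\<in>{1..n}. blaschke_factor (lam k) z)"
    by (simp add: B_def fun_eq_iff blaschke_def blaschke_factor_def)
  have e: "e k \<in> hardy_space" if "k \<in> {1..n}" for k
    unfolding e_def using that lam by (intro malmquist_walsh_in_hardy) auto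
  have Bh: "(\<lambda>z. B z * h z) \<in> hardy_space" if "h \<in> hardy_space" for h
    unfolding B using that lam by (intro hardy_blaschke_prod) auto
  have VH: "V \<subseteq> hardy_space" by (auto simp: V_def model_space_def hardy_orth_def)
  have Vdiff: "(\<lambda>z. f z - h z) \<in> V" if "f \<in> V" "h \<in> V" for f h
    using that Bh by (auto simp: V_def model_space_def hardy_orth_def hardy_diff)
  have g: "g \<in> hardy_space" "\<And>h. h \<in> hardy_space \<Longrightarrow> hardy_inner g h = (\<Sum>k\<in>{1..n}. M k * hardy_inner (e k) h)"
    using hardy_sum[of "{1..n}" e M] e by (auto simp: g_def)
  have gV: "g \<in> V"
  proof -
    have "hardy_inner g (\<lambda>z. B z * h z) = 0" if h: "h \<in> hardy_space" for h
    proof -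
      have "hardy_inner (e k) (\<lambda>z. B z * h z) = 0" if k: "k \<in> {1..n}" for k
        unfolding e_def B
        by (subst hardy_inner_commute) (use blaschke_multiple_orth_malmquist_walsh[of n lam k h] lam k h in simp)
      then show ?thesis using g(2)[OF Bh[OF h]] by simp
    qed
    then show ?thesis using g(1) by (auto simp: V_def model_space_def hardy_orth_def)
  qed
  define w where "w = s j * (\<Prod>\<mu>\<in>{j+1..n}. - cnj (lam \<mu>))"
  have res: "z * e j z - g z = w * (B z * szego_kernel 0 z)" for z
  proof -
    have "g z = (\<Sum>i\<in>{1..<j}. M i * e i z) + (M j * e j z + (\<Sum>i\<in>{j+1..n}. M i * e i z))"
    proof -
      have "{1..n} = {1..<j} \<union> insert j {j+1..n}" using j by auto
      then have "g z = (\<Sum>i\<in>{1..<j} \<union> insert j {j+1..n}. M i * e i z)" by (simp add: g_def)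
      also have "\<dots> = (\<Sum>i\<in>{1..<j}. M i * e i z) + (\<Sum>i\<in>insert j {j+1..n}. M i * e i z)"
        by (rule sum.union_disjoint) auto
      finally show ?thesis by simp
    qed
    also have "(\<Sum>i\<in>{1..<j}. M i * e i z) = 0" by (simp add: M_def)
    also have "M j = lam j" by (simp add: M_def)
    also have "(\<Sum>i\<in>{j+1..n}. M i * e i z) =
        s j * (\<Sum>i\<in>{j+1..n}. s i * (\<Prod>\<mu>\<in>{j+1..i-1}. - cnj (lam \<mu>)) * e i z)"
      unfolding sum_distrib_left by (rule sum.cong) (auto simp: M_def mult_ac)
    finally have gz: "g z = lam j * e j z + s j * (\<Sum>i\<in>{j+1..n}. s i * (\<Prod>\<mu>\<in>{j+1..i-1}. - cnj (lam \<mu>)) * e i z)"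
      by simp
    have "z * e j z = lam j * e j z + s j * blaschke_partial lam j z"
      unfolding e_def s_def using j lam by (intro times_z_malmquist_walsh) auto
    also have "blaschke_partial lam j z =
        (\<Sum>i\<in>{j+1..n}. s i * (\<Prod>\<mu>\<in>{j+1..i-1}. - cnj (lam \<mu>)) * e i z)
        + (\<Prod>\<mu>\<in>{j+1..n}. - cnj (lam \<mu>)) * blaschke_partial lam n z"
      unfolding e_def s_def using j lam by (intro blaschke_partial_expansion) auto
    also have "blaschke_partial lam n z = B z * szego_kernel 0 z" by (simp add: blaschke_partial_def B)
    finally show ?thesis unfolding gz w_def by (simp add: algebra_simps)
  qed
  have one: "szego_kernel 0 \<in> hardy_space" by (rule szego_kernel_reproducing) simp
  have res_orth: "(\<lambda>z. z * e j z - g z) \<in> hardy_orth V"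
  proof -
    have "hardy_inner (\<lambda>z. w * (B z * szego_kernel 0 z)) f = 0" if f: "f \<in> V" for f
    proof -
      have "f \<in> hardy_space" "hardy_inner f (\<lambda>z. B z * szego_kernel 0 z) = 0"
        using f one by (auto simp: V_def model_space_def hardy_orth_def)
      then show ?thesis using hardy_scale(2)[OF Bh[OF one], of f w] hardy_inner_commute[of "\<lambda>z. B z * szego_kernel 0 z" f]
        by simp
    qed
    then show ?thesis unfolding res using hardy_scale(1)[OF Bh[OF one], of w] by (simp add: hardy_orth_def)
  qed
  have "model_operator B (e j) = g"
    unfolding model_operator_def V_def[symmetric] by (rule hardy_proj_eqI[OF VH Vdiff gV res_orth])
  then have "matrix_entry (model_operator B) e i j = (\<Sum>k\<in>{1..n}. M k * hardy_inner (e k) (e i))"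
    using g(2)[OF e[OF i]] by (simp add: matrix_entry_def)
  also have "\<dots> = (\<Sum>k\<in>{1..n}. if k = i then M i else 0)"
  proof (rule sum.cong[OF refl])
    fix k assume k: "k \<in> {1..n}"
    have "hardy_inner (e k) (e i) = (if i = k then 1 else 0)"
      unfolding e_def by (rule malmquist_walsh_orthonormal[OF lam i k])
    then show "M k * hardy_inner (e k) (e i) = (if k = i then M i else 0)" by simp
  qed
  also have "\<dots> = M i" using i by simp
  finally show ?thesis by (simp add: M_def s_def e_def B_def)
qed

section \<open>Roots of the minimal polynomial\<close>

lemma mult_pow_mat:
  assumes "A \<in> carrier_mat n n"
  shows "A * A ^\<^sub>m k = A ^\<^sub>m Suc k"
proof (induction k)
  case 0
  then show ?case using assms by simp
next
  case (Suc k)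
  have "A * A ^\<^sub>m Suc k = A * A ^\<^sub>m k * A"
    using assoc_mult_mat[of A n n "A ^\<^sub>m k" n A n] assms by simp
  then show ?case using Suc by simp
qed

lemma poly_mat_carrier:
  assumes "A \<in> carrier_mat n n"
  shows "poly_mat p A \<in> carrier_mat n n"
  unfolding poly_mat_def carrier_matD(1)[OF assms] by (rule mat_carrier)

lemma poly_mat_index:
  assumes A: "A \<in> carrier_mat n n" and ij: "i < n" "j < n" and N: "degree p \<le> N"
  shows "poly_mat p A $$ (i, j) = (\<Sum>k\<le>N. coeff p k * (A ^\<^sub>m k) $$ (i, j))"
proof -
  have "poly_mat p A $$ (i, j) = (\<Sum>k\<le>degree p. coeff p k * (A ^\<^sub>m k) $$ (i, j))"
    using A ij by (simp add: poly_mat_def)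
  also have "\<dots> = (\<Sum>k\<le>N. coeff p k * (A ^\<^sub>m k) $$ (i, j))"
    using N by (intro sum.mono_neutral_left) (auto simp: coeff_eq_0)
  finally show ?thesis .
qed

lemma poly_mat_linear_factor:
  assumes A: "A \<in> carrier_mat n n" and ij: "i < n" "j < n"
  shows "poly_mat ([:-l, 1:] * q) A $$ (i, j) = (A * poly_mat q A) $$ (i, j) - l * poly_mat q A $$ (i, j)"
proof -
  let ?N = "degree q"
  have Q: "poly_mat q A \<in> carrier_mat n n" by (rule poly_mat_carrier[OF A])
  have "(A * poly_mat q A) $$ (i, j) = (\<Sum>r = 0..<n. A $$ (i, r) * poly_mat q A $$ (r, j))"
    using A Q ij by (auto simp: times_mat_def scalar_prod_def)
  also have "\<dots> = (\<Sum>r = 0..<n. \<Sum>k\<le>?N. coeff q k * (A $$ (i, r) * (A ^\<^sub>m k) $$ (r, j)))"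
    using ij by (intro sum.cong refl) (simp add: poly_mat_index[OF A _ _ order_refl] sum_distrib_left mult_ac)
  also have "\<dots> = (\<Sum>k\<le>?N. coeff q k * (\<Sum>r = 0..<n. A $$ (i, r) * (A ^\<^sub>m k) $$ (r, j)))"
    by (subst sum.swap) (simp add: sum_distrib_left)
  also have "\<dots> = (\<Sum>k\<le>?N. coeff q k * (A ^\<^sub>m Suc k) $$ (i, j))"
  proof (intro sum.cong refl arg_cong2[where f = "(*)"])
    fix k
    have "A ^\<^sub>m k \<in> carrier_mat n n" using A by simp
    then show "(\<Sum>r = 0..<n. A $$ (i, r) * (A ^\<^sub>m k) $$ (r, j)) = (A ^\<^sub>m Suc k) $$ (i, j)"
      unfolding mult_pow_mat[OF A, symmetric] using A ij by (auto simp: times_mat_def scalar_prod_def)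
  qed
  finally have Aq: "(A * poly_mat q A) $$ (i, j) = (\<Sum>k\<le>?N. coeff q k * (A ^\<^sub>m Suc k) $$ (i, j))" .
  have c: "coeff ([:-l, 1:] * q) k = (case k of 0 \<Rightarrow> 0 | Suc k' \<Rightarrow> coeff q k') - l * coeff q k" for k
    by (simp add: coeff_pCons split: nat.split)
  have "degree ([:-l, 1:] * q) \<le> Suc ?N"
    using degree_mult_le[of "[:-l, 1:]" q] by simp
  from poly_mat_index[OF A ij this]
  have "poly_mat ([:-l, 1:] * q) A $$ (i, j) =
     (\<Sum>k\<le>Suc ?N. (case k of 0 \<Rightarrow> 0 | Suc k' \<Rightarrow> coeff q k') * (A ^\<^sub>m k) $$ (i, j))
     - l * (\<Sum>k\<le>Suc ?N. coeff q k * (A ^\<^sub>m k) $$ (i, j))"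
    unfolding c by (simp only: left_diff_distrib sum_subtractf sum_distrib_left mult.assoc)
  also have "(\<Sum>k\<le>Suc ?N. (case k of 0 \<Rightarrow> 0 | Suc k' \<Rightarrow> coeff q k') * (A ^\<^sub>m k) $$ (i, j)) = (A * poly_mat q A) $$ (i, j)"
    unfolding Aq sum.atMost_Suc_shift by simp
  also have "(\<Sum>k\<le>Suc ?N. coeff q k * (A ^\<^sub>m k) $$ (i, j)) = poly_mat q A $$ (i, j)"
    by (rule poly_mat_index[OF A ij, symmetric]) simp
  finally show ?thesis .
qed

text \<open>
  If \<open>m = (x - l) q\<close>, minimality gives \<open>q(A) \<noteq> 0\<close>, and \<open>(A - l) q(A) = 0\<close> makes every nonzero column of
  \<open>q(A)\<close> an eigenvector.
\<close>
lemma minimal_poly_root_in_spectrum: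
  assumes A: "A \<in> carrier_mat n n" and m: "is_minimal_poly A m" and dvd: "[:-l, 1:] dvd m"
  shows "l \<in> spectrum A"
proof -
  obtain q where q: "m = [:-l, 1:] * q" using dvd by (rule dvdE)
  have "m \<noteq> 0" using m by (auto simp: is_minimal_poly_def)
  then have q0: "q \<noteq> 0" using q by auto
  then have deg: "degree q < degree m" unfolding q by (subst degree_mult_eq) auto
  let ?Q = "poly_mat q A"
  have Q: "?Q \<in> carrier_mat n n" by (rule poly_mat_carrier[OF A])
  have "?Q \<noteq> 0\<^sub>m n n"
  proof
    assume "?Q = 0\<^sub>m n n"
    then have "?Q = 0\<^sub>m (dim_row A) (dim_row A)" using A by auto
    then have "degree m \<le> degree q" using m q0 by (auto simp: is_minimal_poly_def)
    then show False using deg by simp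
  qed
  then obtain i j where ij: "i < n" "j < n" "?Q $$ (i, j) \<noteq> 0"
    using Q by (auto simp: mat_eq_iff)
  have "A *\<^sub>v col ?Q j = l \<cdot>\<^sub>v col ?Q j"
  proof (rule eq_vecI)
    fix k assume "k < dim_vec (l \<cdot>\<^sub>v col ?Q j)"
    then have k: "k < n" using Q by simp
    have "poly_mat m A $$ (k, j) = 0" using m A k ij by (simp add: is_minimal_poly_def)
    then have "(A * ?Q) $$ (k, j) = l * ?Q $$ (k, j)"
      using poly_mat_linear_factor[OF A k ij(2), of l q] unfolding q by simp
    then show "(A *\<^sub>v col ?Q j) $ k = (l \<cdot>\<^sub>v col ?Q j) $ k"
      using A Q k ij by simp
  qed (use A Q in simp)
  moreover have "col ?Q j \<noteq> 0\<^sub>v n"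
  proof
    assume "col ?Q j = 0\<^sub>v n"
    then have "col ?Q j $ i = 0" using ij by simp
    then show False using ij Q by simp
  qed
  moreover have "col ?Q j \<in> carrier_vec n" by (rule carrier_vecI) (use Q in simp)
  ultimately have "eigenvector A (col ?Q j) l" using A Q by (simp add: eigenvector_def)
  then show ?thesis by (auto simp: spectrum_def eigenvalue_def)
qed

theorem mainTheorem4:
  fixes A :: "complex mat" and n :: nat and m :: "complex poly"
    and lam :: "nat \<Rightarrow> complex" and B :: "complex \<Rightarrow> complex"
  assumes "A \<in> carrier_mat n n"
    and "spectrum A \<subseteq> ball 0 1"
    and "is_minimal_poly A m"
    and "m = (\<Prod>i=1..degree m. [:- lam i, 1:])"
    and "B = blaschke lam (degree m)"
  shows "\<forall>i\<in>{1..degree m}. \<forall>j\<in>{1..degree m}.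
    matrix_entry (model_operator B) (malmquist_walsh lam) i j =
      (if i < j then 0
       else if i = j then lam i
       else of_real (sqrt (1 - (cmod (lam i))\<^sup>2)) * of_real (sqrt (1 - (cmod (lam j))\<^sup>2))
              * (\<Prod>\<mu>=j+1..i-1. - cnj (lam \<mu>)))"
proof -
  have lam: "cmod (lam k) < 1" if k: "k \<in> {1..degree m}" for k
  proof -
    have "[:- lam k, 1:] dvd (\<Prod>i=1..degree m. [:- lam i, 1:])"
      using k by (intro dvd_prodI) auto
    then have "[:- lam k, 1:] dvd m" using assms(4) by simp
    then have "lam k \<in> spectrum A" by (rule minimal_poly_root_in_spectrum[OF assms(1,3)])
    then show ?thesis using assms(2) by auto
  qed
  show ?thesis unfolding assms(5) by (intro ballI model_operator_matrix lam)
qed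

end
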